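(* For every function $f\colon\{0,1\}^n\to\{0,1\}$, every $0$-biased product distribution $\mu$ over $\{0,1\}^n$, every integer $k\ge 1$ and every $\epsilon\ge 0$, $$\mathsf{S}_\epsilon(f^k,\mu^k)\;\ge\; k\cdot\mathsf{S}_\epsilon(f,\mu).$$
   Context: Inner products are over $\mathbb{F}_2$: $\langle a,x\rangle=\sum_i a_ix_i \bmod 2$. A deterministic parity decision tree $T$ on $\{0,1\}^N$ is a rooted binary tree in which every internal node is labelled by a vector $a\in\{0,1\}^N$ (the query $\langle a,x\rangle$) and has two children, one for each outcome in $\{0,1\}$, and every leaf is labelled by an output value; $T(x)$ is the label of the leaf reached on input $x$, and $q(T,x)$ is the number of queries made by $T$ on $x$. A randomised parity decision tree $\mathcal{T}$ is a probability distribution over deterministic ones. For $g\colon\{0,1\}^N\to\{0,1\}^m$ and a distribution $\nu$ on $\{0,1\}^N$, $\overline{q}(\mathcal{T},\nu)=\mathbb{E}_{T\sim\mathcal{T},x\sim\nu}[q(T,x)]$ and $\mathrm{err}_g(\mathcal{T},\nu)=\Pr_{T\sim\mathcal{T},x\sim\nu}[T(x)\ne g(x)]$. A product distribution $\nu$ on $\{0,1\}^N$ (a product of $N$ independent Bernoulli distributions) is $0$-biased if $\Pr_{x\sim\nu}[x_i=0]\ge 1/2$ for every $i$. For such $\nu$ put $\delta_i=2\Pr_{x\sim\nu}[x_i=1]\in[0,1]$. The random partial fixing $\mathcal{R}_\nu$ is the distribution of $\rho\in\{0,\star\}^N$ with independent coordinates, $\rho_i=0$ with probability $1-\delta_i$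 and $\rho_i=\star$ with probability $\delta_i$. $\mathcal{U}_\rho$ is the uniform distribution on $\{x\in\{0,1\}^N: x_i=0 \text{ whenever }\rho_i=0\}$. For a deterministic tree $T$ and $\rho\in\{0,\star\}^N$, $T_\rho$ is the tree obtained from $T$ by fixing $x_i=0$ for all $i$ with $\rho_i=0$ (so each query is restricted to the coordinates with $\rho_i=\star$) and then removing redundant queries, i.e. those whose restricted query vector is an $\mathbb{F}_2$-linear combination of the restricted query vectors made earlier on the path (their answers are determined by the earlier ones). For randomised $\mathcal{T}$, $\mathcal{T}_\rho$ is the distribution of $T_\rho$ with $T\sim\mathcal{T}$. Skew average cost: $\overline{sq}(\mathcal{T},\nu)=\mathbb{E}_{\rho\sim\mathcal{R}_\nu}[\overline{q}(\mathcal{T}_\rho,\mathcal{U}_\rho)]$. Skew measure: $\mathsf{S}_\epsilon(g,\nu)=\min_{\mathcal{T}}\{\overline{sq}(\mathcal{T},\nu):\mathrm{err}_g(\mathcal{T},\nu)\le\epsilon\}$, the minimum over randomised parity decision trees. $f^k\colon(\{0,1\}^n)^k\to\{0,1\}^k$ is $f^k(x^1,\dots,x^k)=(f(x^1),\dots,f(x^k))$, and $\mu^k=\mu\times\cdots\times\mu$ ($k$ times). *)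

theory Defs
  imports "HOL-Probability.Probability" "HOL-Probability.Product_PMF" "HOL-Library.Z2"
begin

text \<open>
  The space \<open>{0,1}\<^sup>N\<close> is modelled over a finite index set \<open>I\<close> with \<open>N\<close> elements, as the
  set of functions into the field \<open>bit\<close> that vanish outside \<open>I\<close>. This is the support
  convention of \<^const>\<open>Pi_pmf\<close> with default value \<open>0\<close>.
\<close>

definition cube :: "'i set \<Rightarrow> ('i \<Rightarrow> bit) set" where
  "cube I = PiE_dflt I 0 (\<lambda>_. UNIV)"

definition inner_prod :: "'i set \<Rightarrow> ('i \<Rightarrow> bit) \<Rightarrow> ('i \<Rightarrow> bit) \<Rightarrow> bit" where
  "inner_prod I a x = (\<Sum>i\<in>I. a i * x i)"


subsection \<open>Parity decision trees\<close>

text \<open>In \<open>Query a T0 T1\<close> the subtree \<open>T0\<close> belongs to answer \<open>0\<close> and \<open>T1\<close> to answer \<open>1\<close>.\<close>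

datatype ('i, 'o) pdt = Leaf 'o | Query "'i \<Rightarrow> bit" "('i, 'o) pdt" "('i, 'o) pdt"

primrec pdt_over :: "'i set \<Rightarrow> 'o set \<Rightarrow> ('i, 'o) pdt \<Rightarrow> bool" where
  "pdt_over I Y (Leaf y) \<longleftrightarrow> y \<in> Y"
| "pdt_over I Y (Query a T0 T1) \<longleftrightarrow> a \<in> cube I \<and> pdt_over I Y T0 \<and> pdt_over I Y T1"

primrec pdt_output :: "'i set \<Rightarrow> ('i, 'o) pdt \<Rightarrow> ('i \<Rightarrow> bit) \<Rightarrow> 'o" where
  "pdt_output I (Leaf y) x = y"
| "pdt_output I (Query a T0 T1) x =
     (if inner_prod I a x = 0 then pdt_output I T0 x else pdt_output I T1 x)"

primrec num_queries :: "'i set \<Rightarrow> ('i, 'o) pdt \<Rightarrow> ('i \<Rightarrow> bit) \<Rightarrow> nat" where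
  "num_queries I (Leaf y) x = 0"
| "num_queries I (Query a T0 T1) x =
     Suc (if inner_prod I a x = 0 then num_queries I T0 x else num_queries I T1 x)"

text \<open>
  For a fixed finite \<open>I\<close> and countable \<open>Y\<close> there are only countably many trees, so every
  probability distribution over them is a \<open>pmf\<close>.
\<close>

definition randomised_pdts :: "'i set \<Rightarrow> 'o set \<Rightarrow> ('i, 'o) pdt pmf set" where
  "randomised_pdts I Y = {\<T>. \<forall>T\<in>set_pmf \<T>. pdt_over I Y T}"

definition avg_queries :: "'i set \<Rightarrow> ('i, 'o) pdt pmf \<Rightarrow> ('i \<Rightarrow> bit) pmf \<Rightarrow> ennreal" where
  "avg_queries I \<T> \<nu> =
     (\<integral>\<^sup>+ (T, x). of_nat (num_queries I T x) \<partial>measure_pmf (pair_pmf \<T> \<nu>))"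

definition err :: "'i set \<Rightarrow> (('i \<Rightarrow> bit) \<Rightarrow> 'o) \<Rightarrow> ('i, 'o) pdt pmf \<Rightarrow> ('i \<Rightarrow> bit) pmf \<Rightarrow> real" where
  "err I g \<T> \<nu> = measure_pmf.prob (pair_pmf \<T> \<nu>) {(T, x). pdt_output I T x \<noteq> g x}"


subsection \<open>Biased product distributions and random partial fixings\<close>

definition product_distribution :: "'i set \<Rightarrow> ('i \<Rightarrow> bit) pmf \<Rightarrow> bool" where
  "product_distribution I \<nu> \<longleftrightarrow> (\<exists>B :: 'i \<Rightarrow> bit pmf. \<nu> = Pi_pmf I 0 B)"

definition zero_biased :: "'i set \<Rightarrow> ('i \<Rightarrow> bit) pmf \<Rightarrow> bool" where
  "zero_biased I \<nu> \<longleftrightarrow>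
     product_distribution I \<nu> \<and> (\<forall>i\<in>I. measure_pmf.prob \<nu> {x. x i = 0} \<ge> 1 / 2)"

definition star_prob :: "('i \<Rightarrow> bit) pmf \<Rightarrow> 'i \<Rightarrow> real" where
  "star_prob \<nu> i = 2 * measure_pmf.prob \<nu> {x. x i = 1}"

datatype fixing = Zero | Star

definition random_partial_fixing :: "'i set \<Rightarrow> ('i \<Rightarrow> bit) pmf \<Rightarrow> ('i \<Rightarrow> fixing) pmf" where
  "random_partial_fixing I \<nu> =
     Pi_pmf I Zero (\<lambda>i. map_pmf (\<lambda>b. if b then Star else Zero) (bernoulli_pmf (star_prob \<nu> i)))"

definition uniform_on_fixing :: "'i set \<Rightarrow> ('i \<Rightarrow> fixing) \<Rightarrow> ('i \<Rightarrow> bit) pmf" where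
  "uniform_on_fixing I \<rho> = pmf_of_set {x \<in> cube I. \<forall>i\<in>I. \<rho> i = Zero \<longrightarrow> x i = 0}"


subsection \<open>Fixing variables in a tree\<close>

definition restrict_query :: "('i \<Rightarrow> fixing) \<Rightarrow> ('i \<Rightarrow> bit) \<Rightarrow> ('i \<Rightarrow> bit)" where
  "restrict_query \<rho> a = (\<lambda>i. if \<rho> i = Star then a i else 0)"

text \<open>
  A history \<open>H\<close> is a finite set of pairs of a query vector and its answer.
  \<open>implied_answer H v b\<close> says that \<open>v\<close> is a linear combination of the vectors in \<open>H\<close> and that
  \<open>b\<close> is the same linear combination of their answers. If the vectors in \<open>H\<close> are linearly
  independent, as in all histories arising below, there is at most one such \<open>b\<close>.
\<close>

definition implied_answer :: "(('i \<Rightarrow> bit) \<times> bit) set \<Rightarrow> ('i \<Rightarrow> bit) \<Rightarrow> bit \<Rightarrow> bool" where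
  "implied_answer H v b \<longleftrightarrow>
     (\<exists>c :: ('i \<Rightarrow> bit) \<times> bit \<Rightarrow> bit.
        v = (\<lambda>i. \<Sum>h\<in>H. c h * fst h i) \<and> b = (\<Sum>h\<in>H. c h * snd h))"

text \<open>
  The history records only the queries that are kept; since a removed query lies in their
  span, this has the same span as all restricted queries made earlier on the path.
\<close>

primrec fix_tree_aux ::
  "('i \<Rightarrow> fixing) \<Rightarrow> (('i \<Rightarrow> bit) \<times> bit) set \<Rightarrow> ('i, 'o) pdt \<Rightarrow> ('i, 'o) pdt" where
  "fix_tree_aux \<rho> H (Leaf y) = Leaf y"
| "fix_tree_aux \<rho> H (Query a T0 T1) =
     (let v = restrict_query \<rho> a in
      if implied_answer H v 0 then fix_tree_aux \<rho> H T0
      else if implied_answer H v 1 then fix_tree_aux \<rho> H T1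
      else Query v (fix_tree_aux \<rho> (insert (v, 0) H) T0) (fix_tree_aux \<rho> (insert (v, 1) H) T1))"

definition fix_tree :: "('i \<Rightarrow> fixing) \<Rightarrow> ('i, 'o) pdt \<Rightarrow> ('i, 'o) pdt" where
  "fix_tree \<rho> T = fix_tree_aux \<rho> {} T"


subsection \<open>The skew measure\<close>

definition skew_cost :: "'i set \<Rightarrow> ('i, 'o) pdt pmf \<Rightarrow> ('i \<Rightarrow> bit) pmf \<Rightarrow> ennreal" where
  "skew_cost I \<T> \<nu> =
     (\<integral>\<^sup>+ \<rho>. avg_queries I (map_pmf (fix_tree \<rho>) \<T>) (uniform_on_fixing I \<rho>)
        \<partial>measure_pmf (random_partial_fixing I \<nu>))"

text \<open>
  The infimum is a minimum for finite \<open>I\<close> and \<open>Y\<close> and \<open>\<epsilon> \<ge> 0\<close>: removing from every tree the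
  queries that are combinations of earlier ones changes neither the error nor the cost, and
  leaves a distribution on a finite set of trees.
\<close>

definition skew_measure ::
  "'i set \<Rightarrow> 'o set \<Rightarrow> real \<Rightarrow> (('i \<Rightarrow> bit) \<Rightarrow> 'o) \<Rightarrow> ('i \<Rightarrow> bit) pmf \<Rightarrow> ennreal" where
  "skew_measure I Y \<epsilon> g \<nu> =
     (INF \<T> \<in> {\<T> \<in> randomised_pdts I Y. err I g \<T> \<nu> \<le> \<epsilon>}. skew_cost I \<T> \<nu>)"


subsection \<open>Direct powers\<close>

text \<open>
  An element \<open>(x\<^sup>1, \<dots>, x\<^sup>k)\<close> of \<open>({0,1}\<^sup>n)\<^sup>k\<close> is a single function on \<open>{..<k} \<times> {..<n}\<close>; its
  block number \<open>j\<close> is \<open>\<lambda>i. x (j, i)\<close>.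
\<close>

definition direct_power :: "nat \<Rightarrow> (('i \<Rightarrow> bit) \<Rightarrow> bit) \<Rightarrow> (nat \<times> 'i \<Rightarrow> bit) \<Rightarrow> (nat \<Rightarrow> bit)" where
  "direct_power k f x = (\<lambda>j. if j < k then f (\<lambda>i. x (j, i)) else 0)"

definition power_distribution :: "nat \<Rightarrow> ('i \<Rightarrow> bit) pmf \<Rightarrow> (nat \<times> 'i \<Rightarrow> bit) pmf" where
  "power_distribution k \<mu> =
     map_pmf (\<lambda>X (j, i). X j i) (Pi_pmf {..<k} (\<lambda>_. 0) (\<lambda>_. \<mu>))"

end

theory Submission
  imports Defs "HOL-Library.Function_Algebras" "HOL-Library.Discrete_Functions"
begin

text \<open>
  From a tree for \<open>f\<^sup>k\<close> we extract, for every block \<open>i\<close>, a randomised tree for \<open>f\<close>. It draws a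
  partial fixing \<open>\<rho>\<close> of the other blocks and runs the given tree on its own input in block \<open>i\<close> and
  a uniformly random point of the fixed subcube elsewhere. If the part of a query on the free
  coordinates of the other blocks is independent of the earlier ones, its answer is a fresh random
  bit and costs nothing; otherwise adding a combination of earlier queries cancels that part, and
  only block \<open>i\<close> has to be queried. Let \<open>W\<close> be the span of the restricted queries on the path and
  \<open>V\<^sub>i\<close> the space of vectors supported on block \<open>i\<close>. The extracted tree only makes queries in
  \<open>W \<inter> V\<^sub>i\<close>, so its cost after removing redundant queries is at most \<open>dim (W \<inter> V\<^sub>i)\<close>, whereas the
  given tree pays \<open>dim W\<close>. Since the \<open>V\<^sub>i\<close> are in direct sum, the costs of the extracted trees add up
  to at most the cost of the given one, and none of them errs more often.
\<close>

section \<open>Linear algebra over the two-element field\<close>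

text \<open>These rules turn sums and products of bits into bit operations, where ring lemmas do not apply.\<close>
declare add_bit_eq_xor [simp del] and mult_bit_eq_and [simp del]

definition bit_scale :: "bit \<Rightarrow> ('i \<Rightarrow> bit) \<Rightarrow> 'i \<Rightarrow> bit" where
  "bit_scale c v = (\<lambda>i. c * v i)"

interpretation bitvec: vector_space "bit_scale :: bit \<Rightarrow> ('i \<Rightarrow> bit) \<Rightarrow> 'i \<Rightarrow> bit"
  by unfold_locales (auto simp: bit_scale_def fun_eq_iff algebra_simps)

lemma bit_scale_simps [simp]: "bit_scale 0 v = 0" "bit_scale 1 v = v"
  by (simp_all add: bit_scale_def fun_eq_iff)

text \<open>The only scalars are 0 and 1, so closure under scaling comes for free.\<close>

lemma bitvec_subspaceI:
  assumes "0 \<in> S" "\<And>v w. v \<in> S \<Longrightarrow> w \<in> S \<Longrightarrow> v + w \<in> S"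
  shows "bitvec.subspace S"
proof (rule bitvec.subspaceI)
  fix c v assume "v \<in> S"
  then show "bit_scale c v \<in> S"
    using assms(1) by (cases c) auto
qed (use assms in auto)

lemma bitvec_add_self [simp]: "v + v = (0 :: 'i \<Rightarrow> bit)"
  by (simp add: fun_eq_iff flip: mult_2)

lemma bitvec_diff [simp]: "v - w = (v + w :: 'i \<Rightarrow> bit)"
  by (simp add: fun_eq_iff)

lemma bitvec_add_cancel [simp]: "v + (v + w) = (w :: 'i \<Rightarrow> bit)"
  by (simp flip: add.assoc)

text \<open>The coefficient of \<open>v\<close> in a combination is 0 or 1, which gives two cosets
  of the old span.\<close>

lemma bitvec_span_insert: "bitvec.span (insert v S) = bitvec.span S \<union> (+) v ` bitvec.span S"
proof -
  have "(\<exists>k. w + bit_scale k v \<in> bitvec.span S) \<longleftrightarrow> w \<in> bitvec.span S \<or> w \<in> (+) v ` bitvec.span S"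
    for w
  proof
    assume "\<exists>k. w + bit_scale k v \<in> bitvec.span S"
    then obtain k where k: "w + bit_scale k v \<in> bitvec.span S" ..
    show "w \<in> bitvec.span S \<or> w \<in> (+) v ` bitvec.span S"
    proof (cases "k = 0")
      case False
      then have "w = v + (v + w)" "v + w \<in> bitvec.span S"
        using k by (simp_all add: add.commute)
      then show ?thesis by blast
    qed (use k in auto)
  next
    assume "w \<in> bitvec.span S \<or> w \<in> (+) v ` bitvec.span S"
    then show "\<exists>k. w + bit_scale k v \<in> bitvec.span S"
    proof
      assume "w \<in> bitvec.span S"
      then show ?thesis by (intro exI[of _ 0]) simp
    next
      assume "w \<in> (+) v ` bitvec.span S"
      then obtain u where "u \<in> bitvec.span S" "w = v + u" ..
      then have "w + bit_scale 1 v \<in> bitvec.span S"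
        by (simp only: bit_scale_simps add.assoc add.commute[of u] bitvec_add_cancel)
      then show ?thesis ..
    qed
  qed
  then show ?thesis by (auto simp: bitvec.span_insert)
qed

lemma finite_bitvec_span [simp]: "finite S \<Longrightarrow> finite (bitvec.span S)"
  by (induction rule: finite_induct) (auto simp: bitvec_span_insert)

text \<open>For \<open>v\<close> outside the span the two cosets are disjoint. Cardinalities can
  therefore replace dimensions: each independent vector doubles the span.\<close>

lemma card_bitvec_span_insert:
  assumes "finite S" "v \<notin> bitvec.span S"
  shows "card (bitvec.span (insert v S)) = 2 * card (bitvec.span S)"
proof -
  have "w \<notin> bitvec.span S" if "u \<in> bitvec.span S" "w = v + u" for u w
    using that assms(2) bitvec.span_add_eq2 by blast
  then have "bitvec.span S \<inter> (+) v ` bitvec.span S = {}" by blast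
  then show ?thesis
    using assms by (simp add: bitvec_span_insert card_Un_disjoint card_image)
qed

section \<open>Inner products, the cube and separating vectors\<close>

lemma inner_prod_simps [simp]:
  "inner_prod I (a + b) x = inner_prod I a x + inner_prod I b x"
  "inner_prod I a (x + y) = inner_prod I a x + inner_prod I a y"
  "inner_prod I 0 x = 0"
  "inner_prod I a 0 = 0"
  by (simp_all add: inner_prod_def algebra_simps sum.distrib)

lemma inner_prod_delta:
  assumes "finite I" "p \<in> I"
  shows "inner_prod I a (\<lambda>q. if q = p then 1 else 0) = a p"
proof -
  have "inner_prod I a (\<lambda>q. if q = p then 1 else 0) = (\<Sum>q\<in>I. if q = p then a q else 0)"
    unfolding inner_prod_def by (rule sum.cong) auto
  with assms show ?thesis by simp
qed

lemma cube_iff: "x \<in> cube I \<longleftrightarrow> (\<forall>i. i \<notin> I \<longrightarrow> x i = 0)"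
  by (auto simp: cube_def PiE_dflt_def)

lemma zero_in_cube [simp]: "0 \<in> cube I"
  by (simp add: cube_iff)

lemma add_in_cube: "x \<in> cube I \<Longrightarrow> y \<in> cube I \<Longrightarrow> x + y \<in> cube I"
  by (simp add: cube_iff)

lemma bitvec_span_subset_cube: "S \<subseteq> cube I \<Longrightarrow> bitvec.span S \<subseteq> cube I"
  by (intro bitvec.span_minimal bitvec_subspaceI) (auto intro: add_in_cube)

lemma UNIV_bit: "UNIV = {0, 1 :: bit}"
  by (auto intro: bit.exhaust)

instance bit :: finite
  by standard (simp add: UNIV_bit)

lemma cube_not_empty [simp]: "cube I \<noteq> {}"
  using zero_in_cube by blast

lemma finite_cube [simp]: "finite I \<Longrightarrow> finite (cube I)"
  unfolding cube_def by (rule finite_PiE_dflt) auto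

lemma inner_prod_eq_0: "z \<in> cube P \<Longrightarrow> (\<And>p. p \<in> P \<Longrightarrow> v p = 0) \<Longrightarrow> inner_prod I v z = 0"
  unfolding inner_prod_def cube_iff by (intro sum.neutral) auto

text \<open>Duality on the coordinates in \<open>P\<close>: a functional that agrees there with no
  element of the span is nonzero at some vector on which all of \<open>S\<close> vanishes. The
  induction on \<open>S\<close> applies its hypothesis to both \<open>a\<close> and
  \<open>h + a\<close>. The vector \<open>u\<close> later shows that a query answered by a coin
  splits the remaining points into equal halves.\<close>

lemma separating_vector:
  assumes "finite S" "finite I" "P \<subseteq> I"
    and "\<And>w. w \<in> bitvec.span S \<Longrightarrow> \<exists>p\<in>P. w p \<noteq> a p"
  obtains u where "u \<in> cube P" "\<And>h. h \<in> S \<Longrightarrow> inner_prod I h u = 0" "inner_prod I a u = 1"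
proof -
  have "\<exists>u\<in>cube P. (\<forall>h\<in>S. inner_prod I h u = 0) \<and> inner_prod I a u = 1"
    using assms(1,4)
  proof (induction S arbitrary: a rule: finite_induct)
    case empty
    then obtain p where "p \<in> P" "a p = 1" by fastforce
    then show ?case
      using assms(2,3)
      by (intro bexI[of _ "\<lambda>q. if q = p then 1 else 0"])
         (auto simp: cube_iff inner_prod_delta)
  next
    case (insert h S)
    have "\<exists>p\<in>P. w p \<noteq> a p" if "w \<in> bitvec.span S" for w
      using insert.prems[of w] that by (auto simp: bitvec_span_insert)
    from insert.IH[OF this] obtain u
      where u: "u \<in> cube P" "\<forall>h\<in>S. inner_prod I h u = 0" "inner_prod I a u = 1" by blast
    have "\<exists>p\<in>P. w p \<noteq> (h + a) p" if "w \<in> bitvec.span S" for w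
    proof -
      have "h + w \<in> bitvec.span (insert h S)"
        using that by (auto simp: bitvec_span_insert)
      from insert.prems[OF this] obtain p where "p \<in> P" "(h + w) p \<noteq> a p" ..
      then have "w p \<noteq> (h + a) p" by (cases "h p"; cases "w p") auto
      with \<open>p \<in> P\<close> show ?thesis ..
    qed
    from insert.IH[of "h + a", OF this] obtain u'
      where u': "u' \<in> cube P" "\<forall>h\<in>S. inner_prod I h u' = 0"
        "inner_prod I (h + a) u' = 1" by blast
    from u'(3) have u'_sum: "inner_prod I h u' + inner_prod I a u' = 1"
      by (simp only: inner_prod_simps)
    \<comment> \<open>A vector among \<open>u\<close> and \<open>u'\<close> that \<open>h\<close>
      annihilates already works, for \<open>u'\<close> by \<open>u'_sum\<close>. If \<open>h\<close>
      takes the value 1 on both, then \<open>a\<close> vanishes on \<open>u'\<close>, and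
      \<open>u + u'\<close> works.\<close>
    consider "inner_prod I h u = 0" | "inner_prod I h u' = 0"
      | "inner_prod I h u = 1" "inner_prod I h u' = 1" by fastforce
    then show ?case
    proof cases
      case 3
      then have "inner_prod I h (u + u') = 0" "inner_prod I a (u + u') = 1"
        using u(3) u'_sum by simp_all
      moreover have "\<forall>h\<in>S. inner_prod I h (u + u') = 0"
        using u(2) u'(2) by simp
      ultimately show ?thesis
        using add_in_cube[OF u(1) u'(1)] by blast
    qed (use u u' u'_sum in auto)
  qed
  then show thesis using that by blast
qed


section \<open>Implied answers\<close>

lemma implied_answer_span: "implied_answer H w \<beta> \<Longrightarrow> w \<in> bitvec.span (fst ` H)"
proof -
  assume "implied_answer H w \<beta>"
  then obtain c where "w = (\<lambda>i. \<Sum>h\<in>H. c h * fst h i)"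
    by (auto simp: implied_answer_def)
  also have "\<dots> = (\<Sum>h\<in>H. bit_scale (c h) (fst h))"
    by (induction H rule: infinite_finite_induct) (auto simp: bit_scale_def fun_eq_iff)
  finally show ?thesis
    by (auto intro!: bitvec.span_sum bitvec.span_scale intro: bitvec.span_base)
qed

text \<open>Coefficient functions can be added, so the vectors with an implied answer form a
  subspace; indicator coefficients show that it contains the recorded queries.\<close>

lemma span_implied_answer:
  assumes "finite H" "w \<in> bitvec.span (fst ` H)"
  shows "\<exists>\<beta>. implied_answer H w \<beta>"
proof -
  have "bitvec.span (fst ` H) \<subseteq> {w. \<exists>\<beta>. implied_answer H w \<beta>}"
  proof (intro bitvec.span_minimal bitvec_subspaceI)
    show "fst ` H \<subseteq> {w. \<exists>\<beta>. implied_answer H w \<beta>}"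
    proof clarsimp
      fix w b assume "(w, b) \<in> H"
      then have "implied_answer H w b"
        using assms(1) unfolding implied_answer_def
        by (intro exI[of _ "\<lambda>h. if h = (w, b) then 1 else 0"])
           (auto simp: if_distrib[of "\<lambda>x. x * _"] fun_eq_iff cong: if_cong)
      then show "\<exists>b. implied_answer H w b" ..
    qed
    show "0 \<in> {w. \<exists>\<beta>. implied_answer H w \<beta>}"
      by (auto simp: implied_answer_def fun_eq_iff intro!: exI[of _ 0])
    fix v w assume "v \<in> {w. \<exists>\<beta>. implied_answer H w \<beta>}" "w \<in> {w. \<exists>\<beta>. implied_answer H w \<beta>}"
    then show "v + w \<in> {w. \<exists>\<beta>. implied_answer H w \<beta>}"
      unfolding implied_answer_def mem_Collect_eq
    proof (elim exE conjE, goal_cases)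
      case (1 b b' c c')
      then show ?case
        by (intro exI[of _ "c + c'"] exI[of _ "b + b'"])
           (simp add: fun_eq_iff algebra_simps sum.distrib)
    qed
  qed
  then show ?thesis using assms(2) by blast
qed

text \<open>Linearity of the inner product in the query. In particular, a history satisfied by some
  point implies at most one answer to each query.\<close>

lemma implied_answer_consistent:
  assumes "implied_answer H w \<beta>" "\<And>h b. (h, b) \<in> H \<Longrightarrow> inner_prod I h x = b"
  shows "inner_prod I w x = \<beta>"
proof -
  obtain c where c: "w = (\<lambda>i. \<Sum>h\<in>H. c h * fst h i)" "\<beta> = (\<Sum>h\<in>H. c h * snd h)"
    using assms(1) by (auto simp: implied_answer_def)
  have "inner_prod I w x = (\<Sum>h\<in>H. c h * inner_prod I (fst h) x)"
    unfolding c inner_prod_def sum_distrib_left sum_distrib_right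
    by (subst sum.swap) (simp add: mult.assoc)
  also have "\<dots> = \<beta>"
    unfolding c using assms(2) by (intro sum.cong) auto
  finally show ?thesis .
qed

section \<open>Queries along a path\<close>

primrec path_queries :: "'i set \<Rightarrow> ('i, 'o) pdt \<Rightarrow> ('i \<Rightarrow> bit) \<Rightarrow> ('i \<Rightarrow> bit) set" where
  "path_queries I (Leaf y) x = {}"
| "path_queries I (Query a T0 T1) x =
     insert a (if inner_prod I a x = 0 then path_queries I T0 x else path_queries I T1 x)"

text \<open>Leaves carry the queries of their path, so that a leaf reached in a simulation still
  tells which path of the original tree was followed.\<close>

primrec annotate :: "('i \<Rightarrow> bit) set \<Rightarrow> ('i, 'o) pdt \<Rightarrow> ('i, 'o \<times> ('i \<Rightarrow> bit) set) pdt" where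
  "annotate Q (Leaf y) = Leaf (y, Q)"
| "annotate Q (Query a T0 T1) = Query a (annotate (insert a Q) T0) (annotate (insert a Q) T1)"

lemma pdt_output_annotate:
  "pdt_output I (annotate Q T) x = (pdt_output I T x, Q \<union> path_queries I T x)"
  by (induction T arbitrary: Q) auto

lemma pdt_output_map_pdt: "pdt_output I (map_pdt g T) x = g (pdt_output I T x)"
  by (induction T) auto

lemma num_queries_map_pdt: "num_queries I (map_pdt g T) x = num_queries I T x"
  by (induction T) auto

lemma fix_tree_aux_map_pdt: "fix_tree_aux \<rho> H (map_pdt g T) = map_pdt g (fix_tree_aux \<rho> H T)"
  by (induction T arbitrary: H) (auto simp: Let_def)

lemma pdt_over_map_pdt: "pdt_over I Y T \<Longrightarrow> (\<And>y. y \<in> Y \<Longrightarrow> g y \<in> Z) \<Longrightarrow> pdt_over I Z (map_pdt g T)"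
  by (induction T) auto

lemma pdt_output_in: "pdt_over I Y T \<Longrightarrow> pdt_output J T x \<in> Y"
  by (induction T) auto

text \<open>An invariant \<open>R\<close> of the annotations is expressed as a restriction on the
  output set. In this form \<open>pdt_over_simulate\<close> transfers it to simulated trees.\<close>

lemma pdt_over_annotate:
  assumes "pdt_over I Y T" "R Q" "\<And>a Q. R Q \<Longrightarrow> a \<in> cube I \<Longrightarrow> R (insert a Q)"
  shows "pdt_over I (Y \<times> Collect R) (annotate Q T)"
  using assms(1,2) by (induction T arbitrary: Q) (auto intro: assms(3))

lemma pdt_over_UNIV [simp]: "pdt_over UNIV UNIV T"
  by (induction T) (auto simp: cube_iff)

section \<open>Restricted queries and the dimension of their span along a path\<close>

lemma restrict_query_add: "restrict_query \<rho> (v + w) = restrict_query \<rho> v + restrict_query \<rho> w"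
  by (auto simp: restrict_query_def fun_eq_iff)

lemma restrict_query_0 [simp]: "restrict_query \<rho> 0 = 0"
  by (auto simp: restrict_query_def fun_eq_iff)

lemma restrict_query_span:
  assumes "w \<in> bitvec.span S"
  shows "restrict_query \<rho> w \<in> bitvec.span (restrict_query \<rho> ` S)"
proof -
  have "bitvec.span S \<subseteq> {w. restrict_query \<rho> w \<in> bitvec.span (restrict_query \<rho> ` S)}"
    by (intro bitvec.span_minimal bitvec_subspaceI)
       (auto simp: restrict_query_add intro: bitvec.span_base bitvec.span_zero bitvec.span_add)
  then show ?thesis using assms by blast
qed

lemma inner_prod_restrict_query:
  assumes "\<And>i. i \<in> I \<Longrightarrow> \<rho> i = Zero \<Longrightarrow> x i = 0"
  shows "inner_prod I (restrict_query \<rho> a) x = inner_prod I a x"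
  unfolding inner_prod_def restrict_query_def
  by (rule sum.cong) (auto, metis assms fixing.exhaust)

text \<open>A kept query lies outside the span of the history and doubles it; a removed one leaves
  it unchanged. So the exponent counts exactly the kept queries.\<close>

lemma card_span_fix_tree_aux:
  assumes "finite H" "\<And>h b. (h, b) \<in> H \<Longrightarrow> inner_prod I h x = b"
    and "\<And>i. i \<in> I \<Longrightarrow> \<rho> i = Zero \<Longrightarrow> x i = 0"
  shows "card (bitvec.span (fst ` H \<union> restrict_query \<rho> ` path_queries I T x)) =
           card (bitvec.span (fst ` H)) * 2 ^ num_queries I (fix_tree_aux \<rho> H T) x"
  using assms(1,2)
proof (induction T arbitrary: H)
  case (Query a T0 T1)
  define v where "v = restrict_query \<rho> a"
  define b where "b = inner_prod I a x"
  define T where "T = (if b = 0 then T0 else T1)"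
  have v: "inner_prod I v x = b"
    unfolding v_def b_def using assms(3) by (rule inner_prod_restrict_query)
  have IH: "card (bitvec.span (fst ` G \<union> restrict_query \<rho> ` path_queries I T x)) =
      card (bitvec.span (fst ` G)) * 2 ^ num_queries I (fix_tree_aux \<rho> G T) x"
    if "finite G" "\<And>h b. (h, b) \<in> G \<Longrightarrow> inner_prod I h x = b" for G
    using Query.IH that unfolding T_def by auto
  have path: "fst ` H \<union> restrict_query \<rho> ` path_queries I (Query a T0 T1) x =
      insert v (fst ` H \<union> restrict_query \<rho> ` path_queries I T x)"
    by (auto simp: T_def b_def v_def)
  \<comment> \<open>Since \<open>x\<close> satisfies the history, an implied answer is the true one,
    and a removed query continues in the subtree that \<open>x\<close> enters anyway.\<close>
  have implied: "c = b" if "implied_answer H v c" for c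
    using implied_answer_consistent[OF that, of I x] Query.prems(2) v by auto
  show ?case
  proof (cases "v \<in> bitvec.span (fst ` H)")
    case True
    then have "implied_answer H v b"
      using span_implied_answer[OF Query.prems(1) True] implied by auto
    then have "fix_tree_aux \<rho> H (Query a T0 T1) = fix_tree_aux \<rho> H T"
      using implied[of 0] implied[of 1] by (cases b) (auto simp: T_def v_def Let_def)
    moreover have "v \<in> bitvec.span (fst ` H \<union> restrict_query \<rho> ` path_queries I T x)"
      using True bitvec.span_mono[of "fst ` H"] by blast
    ultimately show ?thesis
      unfolding path by (simp add: bitvec.span_redundant IH Query.prems)
  next
    case False
    then have "\<not> implied_answer H v c" for c
      using implied_answer_span by blast
    then have "num_queries I (fix_tree_aux \<rho> H (Query a T0 T1)) x =
        Suc (num_queries I (fix_tree_aux \<rho> (insert (v, b) H) T) x)"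
      using v by (cases b) (auto simp: T_def v_def Let_def)
    moreover have "card (bitvec.span (fst ` insert (v, b) H \<union> restrict_query \<rho> ` path_queries I T x)) =
      card (bitvec.span (fst ` insert (v, b) H)) *
        2 ^ num_queries I (fix_tree_aux \<rho> (insert (v, b) H) T) x"
      using Query.prems v by (intro IH) auto
    ultimately show ?thesis
      unfolding path using Query.prems(1) False by (simp add: card_bitvec_span_insert)
  qed
qed simp

text \<open>With the empty history: the cost of the fixed tree on \<open>x\<close> is the dimension
  of the span of the restricted queries on the path.\<close>

lemma card_span_path_queries:
  assumes "\<And>i. i \<in> I \<Longrightarrow> \<rho> i = Zero \<Longrightarrow> x i = 0"
  shows "card (bitvec.span (restrict_query \<rho> ` path_queries I T x)) =
           2 ^ num_queries I (fix_tree \<rho> T) x"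
  using card_span_fix_tree_aux[of "{}" I x \<rho> T] assms by (simp add: fix_tree_def)


section \<open>Simulating a tree on a single block\<close>

definition in_block :: "'k \<Rightarrow> ('i \<Rightarrow> bit) \<Rightarrow> 'k \<times> 'i \<Rightarrow> bit" where
  "in_block i x = (\<lambda>(j, l). if j = i then x l else 0)"

definition block :: "'k \<Rightarrow> ('k \<times> 'i \<Rightarrow> 'b) \<Rightarrow> 'i \<Rightarrow> 'b" where
  "block i y = (\<lambda>l. y (i, l))"

lemma block_in_block [simp]: "block i (in_block i x) = x"
  by (simp add: block_def in_block_def)

lemma in_block_add: "in_block i (x + y) = in_block i x + in_block i y"
  by (auto simp: in_block_def fun_eq_iff)

lemma block_add: "block i (x + y) = block i x + block i y"
  by (auto simp: block_def fun_eq_iff)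

lemma in_block_0 [simp]: "in_block i 0 = 0"
  by (auto simp: in_block_def fun_eq_iff)

lemma block_in_cube: "y \<in> cube (A \<times> J) \<Longrightarrow> block i y \<in> cube J"
  by (auto simp: cube_iff block_def)

lemma inner_prod_in_block:
  assumes "finite A" "i \<in> A"
  shows "inner_prod (A \<times> J) a (in_block i x) = inner_prod J (block i a) x"
proof -
  have "inner_prod (A \<times> J) a (in_block i x) = (\<Sum>j\<in>A. if j = i then \<Sum>l\<in>J. a (j, l) * x l else 0)"
    unfolding inner_prod_def sum.cartesian_product' in_block_def by (intro sum.cong) auto
  also have "\<dots> = inner_prod J (block i a) x"
    using assms by (simp add: inner_prod_def block_def)
  finally show ?thesis .
qed

text \<open>
  \<open>P\<close> consists of the free coordinates of the blocks other than \<open>i\<close>. The history \<open>H\<close> records only the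
  queries answered by a coin: on \<open>P\<close> they are independent and span all earlier ones.
\<close>
primrec simulate :: "('k \<times> 'i) set \<Rightarrow> 'k \<Rightarrow> (('k \<times> 'i \<Rightarrow> bit) \<times> bit) set \<Rightarrow>
    ('k \<times> 'i, 'o) pdt \<Rightarrow> ('i, 'o) pdt pmf" where
  "simulate P i H (Leaf y) = return_pmf (Leaf y)"
| "simulate P i H (Query a T0 T1) =
     (if \<exists>w \<beta>. implied_answer H w \<beta> \<and> (\<forall>p\<in>P. w p = a p)
      then let (w, \<beta>) = SOME (w, \<beta>). implied_answer H w \<beta> \<and> (\<forall>p\<in>P. w p = a p)
           in do {t0 \<leftarrow> simulate P i H T0;
                  t1 \<leftarrow> simulate P i H T1;
                  return_pmf (Query (block i (a + w)) (if \<beta> = 0 then t0 else t1) (if \<beta> = 0 then t1 else t0))}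
      else do {b \<leftarrow> pmf_of_set (UNIV :: bit set);
               if b = 0 then simulate P i (insert (a, 0) H) T0 else simulate P i (insert (a, 1) H) T1})"

text \<open>Replaces the choice operator by an explicit witness. As \<open>a\<close> is the sum of
  \<open>a + w\<close> and \<open>w\<close>, its answer is the one to \<open>a + w\<close> plus
  \<beta>; this is why \<beta> = 1 swaps the two children.\<close>

lemma simulate_cases:
  assumes "finite H"
  obtains (query) w \<beta> where "implied_answer H w \<beta>" "\<And>p. p \<in> P \<Longrightarrow> w p = a p"
      "simulate P i H (Query a T0 T1) =
         do {t0 \<leftarrow> simulate P i H T0;
             t1 \<leftarrow> simulate P i H T1;
             return_pmf (Query (block i (a + w)) (if \<beta> = 0 then t0 else t1) (if \<beta> = 0 then t1 else t0))}"
  | (coin) "\<And>w. w \<in> bitvec.span (fst ` H) \<Longrightarrow> \<exists>p\<in>P. w p \<noteq> a p"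
      "simulate P i H (Query a T0 T1) =
         do {b \<leftarrow> pmf_of_set UNIV;
             simulate P i (insert (a, b) H) (if b = 0 then T0 else T1)}"
proof (cases "\<exists>w \<beta>. implied_answer H w \<beta> \<and> (\<forall>p\<in>P. w p = a p)")
  case True
  define q where "q = (SOME (w, \<beta>). implied_answer H w \<beta> \<and> (\<forall>p\<in>P. w p = a p))"
  have "case q of (w, \<beta>) \<Rightarrow> implied_answer H w \<beta> \<and> (\<forall>p\<in>P. w p = a p)"
    unfolding q_def by (rule someI_ex) (use True in auto)
  then show thesis
    using True by (intro query[of "fst q" "snd q"])
      (auto simp: q_def[symmetric] case_prod_beta Let_def simp del: split_paired_Ex)
next
  case False
  have "\<exists>p\<in>P. w p \<noteq> a p" if "w \<in> bitvec.span (fst ` H)" for w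
    using span_implied_answer[OF assms that] False by auto
  moreover have "simulate P i H (Query a T0 T1) =
         do {b \<leftarrow> pmf_of_set UNIV;
             simulate P i (insert (a, b) H) (if b = 0 then T0 else T1)}"
    using False by (auto intro!: bind_pmf_cong)
  ultimately show thesis by (rule coin)
qed

lemma pdt_over_simulate:
  assumes "finite H" "t \<in> set_pmf (simulate P i H T)" "pdt_over (A \<times> J) Y T" "fst ` H \<subseteq> cube (A \<times> J)"
  shows "pdt_over J Y t"
  using assms
proof (induction T arbitrary: H t)
  case (Query a T0 T1)
  from Query.prems(1) show ?case
  proof (cases rule: simulate_cases[where P = P and a = a and i = i and ?T0.0 = T0 and ?T1.0 = T1])
    case (query w \<beta>)
    from Query.prems(2) obtain t0 t1 where t: "t0 \<in> set_pmf (simulate P i H T0)"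
        "t1 \<in> set_pmf (simulate P i H T1)"
        "t = Query (block i (a + w)) (if \<beta> = 0 then t0 else t1) (if \<beta> = 0 then t1 else t0)"
      unfolding query(3) by auto
    have "w \<in> cube (A \<times> J)"
      using implied_answer_span[OF query(1)] bitvec_span_subset_cube[OF Query.prems(4)] by blast
    then have "block i (a + w) \<in> cube J"
      using Query.prems(3) by (intro block_in_cube add_in_cube) auto
    then show ?thesis
      using Query.IH(1)[OF Query.prems(1) t(1)] Query.IH(2)[OF Query.prems(1) t(2)] Query.prems(3,4) t(3)
      by auto
  next
    case coin
    from Query.prems(2) obtain b
      where "t \<in> set_pmf (simulate P i (insert (a, b) H) (if b = 0 then T0 else T1))"
      unfolding coin(2) by auto
    then show ?thesis
      using Query.IH(1)[of "insert (a, b) H" t] Query.IH(2)[of "insert (a, b) H" t] Query.prems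
      by (cases b) auto
  qed
qed auto

text \<open>A query is made only in the form \<open>block i (a + w)\<close>, where \<open>w\<close>
  agrees with \<open>a\<close> on \<open>P\<close> and lies in the span of the history. Both
  \<open>a\<close> and the history belong to the annotation, which only grows towards the
  leaf.\<close>

lemma path_queries_simulate:
  assumes "finite H" "t \<in> set_pmf (simulate P i H (annotate Q T))" "fst ` H \<subseteq> Q"
    and "v \<in> path_queries J t x"
  shows "\<exists>w \<in> bitvec.span (snd (pdt_output J t x)). (\<forall>p\<in>P. w p = 0) \<and> block i w = v"
  using assms
proof (induction T arbitrary: H t Q)
  case (Query a T0 T1)
  note [simp del] = simulate.simps(2)
  \<comment> \<open>Containing \<open>Q\<close> is an invariant of annotations. It is carried over
    by \<open>pdt_over_simulate\<close> with full index sets, where every query is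
    admissible.\<close>
  have annotate_mono: "Q \<subseteq> snd (pdt_output J t x)"
    if "t \<in> set_pmf (simulate P i H (annotate Q T))" "finite H" for H t Q and T :: "('a \<times> 'b, 'c) pdt"
  proof -
    have "pdt_over UNIV (UNIV \<times> {Q'. Q \<subseteq> Q'}) t"
      using that pdt_over_annotate[of UNIV UNIV T "\<lambda>Q'. Q \<subseteq> Q'" Q]
      by (intro pdt_over_simulate[where A = UNIV and J = UNIV and i = i and T = "annotate Q T"])
        (auto simp: cube_iff subset_iff)
    from pdt_output_in[OF this, of J x] show ?thesis by auto
  qed
  from Query.prems(1) show ?case
  proof (cases rule: simulate_cases[where P = P and a = a and i = i
        and ?T0.0 = "annotate (insert a Q) T0" and ?T1.0 = "annotate (insert a Q) T1"])
    case (query w \<beta>)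
    from Query.prems(2) obtain t0 t1 where t: "t0 \<in> set_pmf (simulate P i H (annotate (insert a Q) T0))"
        "t1 \<in> set_pmf (simulate P i H (annotate (insert a Q) T1))"
        "t = Query (block i (a + w)) (if \<beta> = 0 then t0 else t1) (if \<beta> = 0 then t1 else t0)"
      unfolding annotate.simps query(3) by auto
    \<comment> \<open>The subtree that \<open>t\<close> enters on \<open>x\<close>, with the swap
      for \<beta> = 1 taken into account.\<close>
    define t' where "t' = (if (inner_prod J (block i (a + w)) x = 0) = (\<beta> = 0) then t0 else t1)"
    have t': "pdt_output J t x = pdt_output J t' x"
        "path_queries J t x = insert (block i (a + w)) (path_queries J t' x)"
      unfolding t(3) t'_def by auto
    have Q: "insert a Q \<subseteq> snd (pdt_output J t x)"
      unfolding t'(1) t'_def using annotate_mono[OF t(1)] annotate_mono[OF t(2)] Query.prems(1)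
      by (simp split: if_split)
    show ?thesis
    proof (cases "v = block i (a + w)")
      case True
      have "w \<in> bitvec.span (snd (pdt_output J t x))"
        using implied_answer_span[OF query(1)] Query.prems(3) Q
          bitvec.span_mono[of "fst ` H" "snd (pdt_output J t x)"] by blast
      then have "a + w \<in> bitvec.span (snd (pdt_output J t x))"
        using Q by (intro bitvec.span_add) (auto intro: bitvec.span_base)
      moreover have "\<forall>p\<in>P. (a + w) p = 0"
        using query(2) by simp
      ultimately show ?thesis
        using True by blast
    next
      case False
      then have "v \<in> path_queries J t' x"
        using Query.prems(4) t'(2) by auto
      moreover have "fst ` H \<subseteq> insert a Q"
        using Query.prems(3) by blast
      ultimately show ?thesis
        using Query.IH(1)[OF Query.prems(1) t(1)] Query.IH(2)[OF Query.prems(1) t(2)]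
        unfolding t'(1) t'_def by presburger
    qed
  next
    case coin
    from Query.prems(2) obtain b
      where "t \<in> set_pmf (simulate P i (insert (a, b) H)
        (if b = 0 then annotate (insert a Q) T0 else annotate (insert a Q) T1))"
      unfolding annotate.simps coin(2) by (simp only: set_bind_pmf) blast
    then show ?thesis
      using Query.IH(1)[of "insert (a, b) H" t "insert a Q"] Query.IH(2)[of "insert (a, b) H" t "insert a Q"]
        Query.prems
      by (cases b) auto
  qed
qed auto

text \<open>The values of the free coordinates of the other blocks that the coins tossed so far
  leave possible, given the input \<open>y\<close> in block \<open>i\<close>; an affine subspace if
  nonempty.\<close>

definition consistent :: "('k \<times> 'i) set \<Rightarrow> ('k \<times> 'i) set \<Rightarrow> (('k \<times> 'i \<Rightarrow> bit) \<times> bit) set \<Rightarrow>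
    ('k \<times> 'i \<Rightarrow> bit) \<Rightarrow> ('k \<times> 'i \<Rightarrow> bit) set" where
  "consistent I P H y = {z \<in> cube P. \<forall>(h, b)\<in>H. inner_prod I h (y + z) = b}"

text \<open>Deferred decisions: drawing \<open>z\<close> uniformly at the start amounts to tossing a
  coin whenever an answer is not yet determined. The induction keeps \<open>z\<close> uniform among
  the points consistent with the history.\<close>

lemma simulate_output:
  assumes "finite A" "finite J" "i \<in> A" "P \<subseteq> A \<times> J" "finite H"
    and "consistent (A \<times> J) P H (in_block i x) \<noteq> {}"
  shows "map_pmf (\<lambda>t. pdt_output J t x) (simulate P i H T) =
           map_pmf (\<lambda>z. pdt_output (A \<times> J) T (in_block i x + z))
             (pmf_of_set (consistent (A \<times> J) P H (in_block i x)))"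
  using assms(5,6)
proof (induction T arbitrary: H)
  case (Leaf y)
  then show ?case by (simp add: map_pmf_const)
next
  case (Query a T0 T1)
  define I y where "I = A \<times> J" and "y = in_block i x"
  define C where "C = consistent I P H y"
  define branch where "branch b = (if b = 0 then T0 else T1)" for b :: bit
  have IH: "map_pmf (\<lambda>t. pdt_output J t x) (simulate P i G (branch b)) =
      map_pmf (\<lambda>z. pdt_output I (branch b) (y + z)) (pmf_of_set (consistent I P G y))"
    if "finite G" "consistent I P G y \<noteq> {}" for G b
    using Query.IH(1)[OF that[unfolded I_def y_def]] Query.IH(2)[OF that[unfolded I_def y_def]]
    unfolding I_def y_def branch_def by (simp only: split: if_split) blast
  have out_Query: "pdt_output I (Query a T0 T1) z = pdt_output I (branch (inner_prod I a z)) z" for z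
    by (simp add: branch_def)
  have "finite P"
    using assms(1,2,4) finite_subset by blast
  then have C: "finite C" "C \<noteq> {}"
    using Query.prems(2) by (auto simp: C_def I_def y_def consistent_def)
  from Query.prems(1) have "map_pmf (\<lambda>t. pdt_output J t x) (simulate P i H (Query a T0 T1)) =
      map_pmf (\<lambda>z. pdt_output I (Query a T0 T1) (y + z)) (pmf_of_set C)"
  proof (cases rule: simulate_cases[where P = P and a = a and i = i and ?T0.0 = T0 and ?T1.0 = T1])
    case (query w \<beta>)
    define v where "v = block i (a + w)"
    define c where "c = inner_prod J v x + \<beta>"
    \<comment> \<open>All consistent points give \<open>a\<close> the same answer:
      \<open>a + w\<close> vanishes on \<open>P\<close> and sees only \<open>y\<close>, while
      \<open>w\<close> has the implied answer \<beta>.\<close>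
    have c: "inner_prod I a (y + z) = c" if "z \<in> C" for z
    proof -
      have "inner_prod I w (y + z) = \<beta>"
        using that by (intro implied_answer_consistent[OF query(1)]) (auto simp: C_def consistent_def)
      moreover have "inner_prod I (a + w) z = 0"
        using that query(2) by (intro inner_prod_eq_0[of _ P]) (auto simp: C_def consistent_def)
      moreover have "inner_prod I (a + w) y = inner_prod J v x"
        unfolding I_def y_def v_def using assms(1,3) by (rule inner_prod_in_block)
      moreover have "inner_prod I a (y + z) =
          inner_prod I (a + w) y + inner_prod I (a + w) z + inner_prod I w (y + z)"
        by (simp add: algebra_simps flip: mult_2)
      ultimately show ?thesis by (simp add: c_def)
    qed
    have out: "pdt_output J (Query v (if \<beta> = 0 then t0 else t1) (if \<beta> = 0 then t1 else t0)) x =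
        pdt_output J (if c = 0 then t0 else t1) x" for t0 t1 :: "('b, 'c) pdt"
      by (cases \<beta>; cases "inner_prod J v x") (auto simp: c_def)
    have "map_pmf (\<lambda>t. pdt_output J t x) (simulate P i H (Query a T0 T1)) =
        do {t0 \<leftarrow> simulate P i H T0; t1 \<leftarrow> simulate P i H T1;
            return_pmf (pdt_output J (if c = 0 then t0 else t1) x)}"
      unfolding query(3) map_bind_pmf map_return_pmf v_def[symmetric] out ..
    also have "\<dots> = map_pmf (\<lambda>t. pdt_output J t x) (simulate P i H (branch c))"
      by (simp add: branch_def map_pmf_def)
    also have "\<dots> = map_pmf (\<lambda>z. pdt_output I (branch c) (y + z)) (pmf_of_set C)"
      unfolding C_def by (rule IH) (use Query.prems in \<open>auto simp: I_def y_def\<close>)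
    also have "\<dots> = map_pmf (\<lambda>z. pdt_output I (Query a T0 T1) (y + z)) (pmf_of_set C)"
      unfolding out_Query by (intro map_pmf_cong refl) (use C c in simp)
    finally show ?thesis .
  next
    case coin
    define C' where "C' b = {z \<in> C. inner_prod I a (y + z) = b}" for b
    have C': "C' b = consistent I P (insert (a, b) H) y" for b
      by (auto simp: C'_def C_def consistent_def)
    \<comment> \<open>Shifting by \<open>u\<close> preserves the recorded answers and flips the
      answer to \<open>a\<close>. Hence both answers have equally many consistent points, and the
      answer to \<open>a\<close> is a fair coin.\<close>
    obtain u where u: "u \<in> cube P" "\<And>h. h \<in> fst ` H \<Longrightarrow> inner_prod I h u = 0" "inner_prod I a u = 1"
      using separating_vector[of "fst ` H" I P a] coin(1) Query.prems(1) assms(1,2,4)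
      unfolding I_def by blast
    have shift: "z + u \<in> C' (b + 1)" if "z \<in> C' b" for z b
    proof -
      have "z + u \<in> cube P"
        using that u(1) add_in_cube unfolding C'_def C_def consistent_def by blast
      moreover have "inner_prod I h (y + (z + u)) = b'" if "(h, b') \<in> H" for h b'
        using that \<open>z \<in> C' b\<close> u(2)[of h] by (force simp: C'_def C_def consistent_def)
      moreover have "inner_prod I a (y + (z + u)) = b + 1"
        using that u(3) by (auto simp: C'_def add.assoc[symmetric])
      ultimately show ?thesis
        by (auto simp: C'_def C_def consistent_def)
    qed
    have inj: "inj_on (\<lambda>z. z + u) X" for X by (rule inj_onI) simp
    have fin: "finite (C' b)" for b using C(1) by (simp add: C'_def)
    have le: "card (C' b) \<le> card (C' (b + 1))" for b
      using shift by (intro card_inj_on_le[OF inj]) (auto simp: fin)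
    have card: "card (C' b) = card (C' 0)" for b
      using le[of 0] le[of 1] by (cases b) auto
    \<comment> \<open>Some point is consistent, so the half containing it is nonempty, and by equal
      cardinality so is the other.\<close>
    obtain z where z: "z \<in> C' (inner_prod I a (y + z))" using C(2) by (auto simp: C'_def)
    have ne: "C' b \<noteq> {}" for b
      using z fin card by (metis card_0_eq empty_iff)
    have "pmf_of_set C = pmf_of_set (\<Union>b\<in>UNIV. C' b)"
      by (rule arg_cong[of _ _ pmf_of_set]) (auto simp: C'_def)
    also have "\<dots> = do {b \<leftarrow> pmf_of_set UNIV; pmf_of_set (C' b)}"
      using fin ne card by (intro pmf_of_set_UN) (auto simp: disjoint_family_on_def C'_def)
    finally have split: "pmf_of_set C = do {b \<leftarrow> pmf_of_set UNIV; pmf_of_set (C' b)}" .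
    have "map_pmf (\<lambda>t. pdt_output J t x) (simulate P i H (Query a T0 T1)) =
        do {b \<leftarrow> pmf_of_set UNIV;
            map_pmf (\<lambda>t. pdt_output J t x) (simulate P i (insert (a, b) H) (branch b))}"
      unfolding coin(2) map_bind_pmf branch_def ..
    also have "\<dots> = do {b \<leftarrow> pmf_of_set UNIV;
            map_pmf (\<lambda>z. pdt_output I (branch b) (y + z)) (pmf_of_set (C' b))}"
      using ne Query.prems(1) unfolding C' by (subst IH) auto
    also have "\<dots> = do {b \<leftarrow> pmf_of_set UNIV;
            map_pmf (\<lambda>z. pdt_output I (Query a T0 T1) (y + z)) (pmf_of_set (C' b))}"
      unfolding out_Query using fin ne
      by (intro bind_pmf_cong map_pmf_cong refl) (auto simp: C'_def set_pmf_of_set)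
    also have "\<dots> = map_pmf (\<lambda>z. pdt_output I (Query a T0 T1) (y + z)) (pmf_of_set C)"
      unfolding split map_bind_pmf ..
    finally show ?thesis .
  qed
  then show ?case by (simp only: C_def I_def y_def)
qed


section \<open>Block ranks\<close>

text \<open>
  Over the two-element field the dimension of a finite subspace is the binary logarithm of its
  cardinality.
\<close>
definition block_rank :: "'k \<Rightarrow> ('k \<times> 'i \<Rightarrow> bit) set \<Rightarrow> nat" where
  "block_rank i W = floor_log (card {v. in_block i v \<in> W})"

lemma in_block_inj: "inj (in_block i)"
  by (metis block_in_block injI)

lemma finite_in_block: "finite W \<Longrightarrow> finite {v. in_block i v \<in> W}"
  using finite_vimageI[OF _ in_block_inj] by (simp add: vimage_def)

lemma subspace_in_block: "bitvec.subspace W \<Longrightarrow> bitvec.subspace {v. in_block i v \<in> W}"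
  by (intro bitvec_subspaceI) (auto simp: in_block_add intro: bitvec.subspace_0 bitvec.subspace_add)

text \<open>The block subspaces are in direct sum: adding up one vector per block stays in
  \<open>W\<close>, and the blocks of the sum recover the summands.\<close>

lemma prod_card_in_block_le:
  assumes "finite A" "finite W" "bitvec.subspace W"
  shows "(\<Prod>i\<in>A. card {v. in_block i v \<in> W}) \<le> card W"
proof -
  define F where "F g = (\<Sum>i\<in>A. in_block i (g i))" for g :: "'a \<Rightarrow> 'b \<Rightarrow> bit"
  have block_F: "block i (F g) = g i" if "i \<in> A" for i g
  proof -
    have "block i (F g) = (\<Sum>j\<in>A. block i (in_block j (g j)))"
      unfolding F_def by (induction A rule: infinite_finite_induct) (auto simp: block_add, simp_all add: block_def fun_eq_iff)
    also have "\<dots> = (\<Sum>j\<in>A. if j = i then g i else 0)"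
      by (intro sum.cong) (auto simp: block_def in_block_def fun_eq_iff)
    finally show ?thesis using assms(1) that by simp
  qed
  have "(\<Prod>i\<in>A. card {v. in_block i v \<in> W}) = card (PiE A (\<lambda>i. {v. in_block i v \<in> W}))"
    using assms(1) by (simp add: card_PiE)
  also have "\<dots> \<le> card W"
  proof (rule card_inj_on_le[where f = F])
    show "inj_on F (PiE A (\<lambda>i. {v. in_block i v \<in> W}))"
      by (rule inj_onI, rule PiE_ext) (assumption+, metis block_F)
    show "F ` PiE A (\<lambda>i. {v. in_block i v \<in> W}) \<subseteq> W"
      unfolding F_def using assms(3) by (auto intro!: bitvec.subspace_sum)
  qed fact
  finally show ?thesis .
qed

text \<open>The logarithm of \<open>prod_card_in_block_le\<close>; rounding down in
  \<open>floor_log\<close> goes in the right direction.\<close>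

lemma sum_block_rank_le:
  assumes "finite A" "bitvec.subspace W" "card W = 2 ^ n"
  shows "(\<Sum>i\<in>A. block_rank i W) \<le> n"
proof -
  have W: "finite W" using assms(3) card.infinite by fastforce
  have "2 ^ (\<Sum>i\<in>A. block_rank i W) = (\<Prod>i\<in>A. 2 ^ block_rank i W)"
    by (simp add: power_sum)
  also have "\<dots> \<le> (\<Prod>i\<in>A. card {v. in_block i v \<in> W})"
  proof (rule prod_mono, safe)
    fix i
    have "0 \<in> {v. in_block i v \<in> W}"
      using bitvec.subspace_0[OF assms(2)] by simp
    then have "card {v. in_block i v \<in> W} > 0"
      using finite_in_block[OF W] by (metis card_gt_0_iff empty_iff)
    then show "2 ^ block_rank i W \<le> card {v. in_block i v \<in> W}"
      unfolding block_rank_def by (rule floor_log_exp2_le)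
  qed
  also have "\<dots> \<le> 2 ^ n"
    using prod_card_in_block_le[OF assms(1) W assms(2)] assms(3) by simp
  finally show ?thesis by simp
qed

lemma sum_block_rank_path_queries_le:
  assumes "finite A" "\<And>i. i \<in> I \<Longrightarrow> \<rho> i = Zero \<Longrightarrow> y i = 0"
  shows "(\<Sum>i\<in>A. block_rank i (bitvec.span (restrict_query \<rho> ` path_queries I T y)))
           \<le> num_queries I (fix_tree \<rho> T) y"
  using assms(1) bitvec.subspace_span card_span_path_queries[OF assms(2)]
  by (rule sum_block_rank_le)

definition other_stars :: "'k set \<Rightarrow> 'i set \<Rightarrow> 'k \<Rightarrow> ('k \<times> 'i \<Rightarrow> fixing) \<Rightarrow> ('k \<times> 'i) set" where
  "other_stars A J i \<rho> = {(j, l) \<in> A \<times> J. j \<noteq> i \<and> \<rho> (j, l) = Star}"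

text \<open>Every query of \<open>t\<close> is block \<open>i\<close> of a vector \<open>w\<close>
  in the span of the annotation that vanishes on the free coordinates of the other blocks.
  Restriction by \<rho> leaves only its part in block \<open>i\<close>, so all restricted queries of
  \<open>t\<close> embed into \<open>W\<close>, and the cost is the dimension of their span.\<close>

lemma num_queries_simulate_le:
  assumes "finite A" "finite J" "i \<in> A" "pdt_over (A \<times> J) Y T"
    and "t \<in> set_pmf (simulate (other_stars A J i \<rho>) i {} (annotate {} T))"
    and "\<And>l. l \<in> J \<Longrightarrow> \<rho> (i, l) = Zero \<Longrightarrow> x l = 0"
  shows "num_queries J (fix_tree (block i \<rho>) t) x
           \<le> block_rank i (bitvec.span (restrict_query \<rho> ` snd (pdt_output J t x)))"
proof -
  define Q where "Q = snd (pdt_output J t x)"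
  define W where "W = bitvec.span (restrict_query \<rho> ` Q)"
  have "pdt_over J (Y \<times> {Q. finite Q \<and> Q \<subseteq> cube (A \<times> J)}) t"
    using assms(4,5) pdt_over_annotate[of "A \<times> J" Y T "\<lambda>Q. finite Q \<and> Q \<subseteq> cube (A \<times> J)" "{}"]
    by (intro pdt_over_simulate[where A = A and T = "annotate {} T"]) auto
  then have Q: "finite Q" "Q \<subseteq> cube (A \<times> J)"
    using pdt_output_in[of J _ t J x] unfolding Q_def by fastforce+
  have "restrict_query (block i \<rho>) v \<in> {v. in_block i v \<in> W}" if v: "v \<in> path_queries J t x" for v
  proof -
    obtain w where w: "w \<in> bitvec.span Q" "\<forall>p\<in>other_stars A J i \<rho>. w p = 0" "block i w = v"
      using path_queries_simulate[OF finite.emptyI assms(5) _ v] unfolding Q_def by auto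
    have "w \<in> cube (A \<times> J)"
      using w(1) bitvec_span_subset_cube[OF Q(2)] by blast
    \<comment> \<open>In the other blocks \<open>w\<close> is 0 at the stars and the restriction
      erases the rest; outside the index set \<open>w\<close> is 0 by membership in the
      cube.\<close>
    then have "in_block i (restrict_query (block i \<rho>) v) = restrict_query \<rho> w"
      using w(2) unfolding w(3)[symmetric]
      by (auto simp: fun_eq_iff in_block_def restrict_query_def block_def other_stars_def cube_iff)
    then show ?thesis
      using restrict_query_span[OF w(1)] by (simp add: W_def)
  qed
  then have "bitvec.span (restrict_query (block i \<rho>) ` path_queries J t x) \<subseteq> {v. in_block i v \<in> W}"
    unfolding W_def by (intro bitvec.span_minimal subspace_in_block bitvec.subspace_span) auto
  then have "card (bitvec.span (restrict_query (block i \<rho>) ` path_queries J t x))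
      \<le> card {v. in_block i v \<in> W}"
    using Q(1) by (intro card_mono finite_in_block) (auto simp: W_def)
  then have "2 ^ num_queries J (fix_tree (block i \<rho>) t) x \<le> card {v. in_block i v \<in> W}"
    using assms(6) by (subst (asm) card_span_path_queries) (auto simp: block_def)
  \<comment> \<open>\<open>floor_log\<close> is monotone and exact at powers of two.\<close>
  then have "num_queries J (fix_tree (block i \<rho>) t) x \<le> block_rank i W"
    unfolding block_rank_def using floor_log_le_iff floor_log_power by metis
  then show ?thesis unfolding W_def Q_def .
qed

section \<open>Random partial fixings\<close>

text \<open>Resampling one independent coordinate from its own law does not change the product
  law.\<close>

lemma Pi_pmf_update:
  assumes "finite A" "i \<in> A"
  shows "do {y \<leftarrow> p i; f \<leftarrow> Pi_pmf A d p; return_pmf (f(i := y))} = Pi_pmf A d p"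
proof -
  have "Pi_pmf A d p = map_pmf (\<lambda>(y, f). f(i := y)) (pair_pmf (p i) (Pi_pmf (A - {i}) d p))"
    using Pi_pmf_insert[of "A - {i}" i d p] assms by (simp add: insert_absorb)
  also have "\<dots> = do {y \<leftarrow> p i; f \<leftarrow> Pi_pmf A d p; return_pmf (f(i := y))}"
    unfolding Pi_pmf_remove[OF assms(1)]
    by (simp add: pair_pmf_def map_pmf_def bind_assoc_pmf bind_return_pmf)
  finally show ?thesis ..
qed

text \<open>A product of products is a product over pairs. Uncurrying is injective, so point masses
  can be compared.\<close>

lemma Pi_pmf_uncurry:
  assumes "finite A" "finite B"
  shows "map_pmf (\<lambda>X (j, i). X j i) (Pi_pmf A (\<lambda>_. d) (\<lambda>j. Pi_pmf B d (p j))) =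
           Pi_pmf (A \<times> B) d (\<lambda>(j, i). p j i)"
proof (rule pmf_eqI)
  fix f :: "'a \<times> 'b \<Rightarrow> 'c"
  have inj: "inj (\<lambda>X (j, i). X j i :: 'c)"
    by (auto simp: inj_def fun_eq_iff)
  have f: "f = (\<lambda>X (j, i). X j i) (\<lambda>j i. f (j, i))"
    by auto
  have "pmf (map_pmf (\<lambda>X (j, i). X j i) (Pi_pmf A (\<lambda>_. d) (\<lambda>j. Pi_pmf B d (p j)))) f =
      pmf (Pi_pmf A (\<lambda>_. d) (\<lambda>j. Pi_pmf B d (p j))) (\<lambda>j i. f (j, i))"
    by (subst f, subst pmf_map_inj'[OF inj]) simp
  also have "\<dots> = pmf (Pi_pmf (A \<times> B) d (\<lambda>(j, i). p j i)) f"
  proof (cases "\<forall>q. q \<notin> A \<times> B \<longrightarrow> f q = d")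
    case True
    then have "pmf (Pi_pmf A (\<lambda>_. d) (\<lambda>j. Pi_pmf B d (p j))) (\<lambda>j i. f (j, i)) =
        (\<Prod>j\<in>A. pmf (Pi_pmf B d (p j)) (\<lambda>i. f (j, i)))"
      using assms by (intro pmf_Pi') auto
    also have "\<dots> = (\<Prod>j\<in>A. \<Prod>i\<in>B. pmf (p j i) (f (j, i)))"
      using True assms by (intro prod.cong pmf_Pi') auto
    also have "\<dots> = (\<Prod>(j, i)\<in>A \<times> B. pmf (p j i) (f (j, i)))"
      by (simp add: prod.cartesian_product)
    also have "\<dots> = pmf (Pi_pmf (A \<times> B) d (\<lambda>(j, i). p j i)) f"
      using True assms by (subst pmf_Pi') (auto simp: case_prod_beta)
    finally show ?thesis .
  next
    case False
    then obtain j i where ji: "(j, i) \<notin> A \<times> B" "f (j, i) \<noteq> d" by auto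
    \<comment> \<open>For \<open>j\<close> in \<open>A\<close> the factor of row \<open>j\<close>
      vanishes; otherwise row \<open>j\<close> differs from the constant default row.\<close>
    have "pmf (Pi_pmf A (\<lambda>_. d) (\<lambda>j. Pi_pmf B d (p j))) (\<lambda>j i. f (j, i)) = 0"
    proof (cases "j \<in> A")
      case True
      then have "pmf (Pi_pmf B d (p j)) (\<lambda>i. f (j, i)) = 0"
        using ji assms by (intro pmf_Pi_outside) auto
      then have "(\<Prod>j\<in>A. pmf (Pi_pmf B d (p j)) (\<lambda>i. f (j, i))) = 0"
        using True assms(1) by (intro prod_zero) auto
      then show ?thesis
        by (simp only: pmf_Pi[OF assms(1)] if_cancel)
    next
      case False
      then show ?thesis
        using ji assms by (intro pmf_Pi_outside) (auto simp: fun_eq_iff)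
    qed
    moreover have "pmf (Pi_pmf (A \<times> B) d (\<lambda>(j, i). p j i)) f = 0"
      using ji assms by (intro pmf_Pi_outside) auto
    ultimately show ?thesis by simp
  qed
  finally show "pmf (map_pmf (\<lambda>X (j, i). X j i) (Pi_pmf A (\<lambda>_. d) (\<lambda>j. Pi_pmf B d (p j)))) f =
      pmf (Pi_pmf (A \<times> B) d (\<lambda>(j, i). p j i)) f" .
qed

section \<open>Biased bits as mixtures of constant and uniform bits\<close>

lemma Pi_pmf_prob_component:
  assumes "finite I" "i \<in> I"
  shows "measure_pmf.prob (Pi_pmf I d B) {x. x i = b} = pmf (B i) b"
proof -
  have "measure_pmf.prob (Pi_pmf I d B) {x. x i = b} = pmf (map_pmf (\<lambda>x. x i) (Pi_pmf I d B)) b"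
    by (simp add: pmf_map vimage_def)
  then show ?thesis
    using assms by (simp add: Pi_pmf_component)
qed

lemma pmf_bit_0: "pmf p (0 :: bit) = 1 - pmf p 1"
proof -
  have "sum (pmf p) UNIV = 1"
    by (rule sum_pmf_eq_1) auto
  then show ?thesis by (simp add: UNIV_bit)
qed

lemma pmf_bit_eqI: "pmf p (1 :: bit) = pmf q 1 \<Longrightarrow> p = q"
  by (rule pmf_eqI) (metis bit.exhaust pmf_bit_0)

lemma star_prob_Pi_pmf:
  "finite I \<Longrightarrow> i \<in> I \<Longrightarrow> star_prob (Pi_pmf I 0 B) i = 2 * pmf (B i) 1"
  unfolding star_prob_def by (simp add: Pi_pmf_prob_component)

lemma uniform_on_fixing_cube: "uniform_on_fixing I \<rho> = pmf_of_set (cube {i\<in>I. \<rho> i = Star})"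
  unfolding uniform_on_fixing_def
  by (rule arg_cong[of _ _ pmf_of_set]) (auto simp: cube_iff, metis fixing.exhaust)

lemma set_uniform_on_fixing:
  "finite I \<Longrightarrow> set_pmf (uniform_on_fixing I \<rho>) = cube {i\<in>I. \<rho> i = Star}"
  unfolding uniform_on_fixing_cube by (intro set_pmf_of_set) simp_all

lemma uniform_on_fixing_Pi_pmf:
  assumes "finite I"
  shows "uniform_on_fixing I \<rho> = Pi_pmf I 0 (\<lambda>i. pmf_of_set (if \<rho> i = Star then UNIV else {0}))"
proof -
  have "cube {i\<in>I. \<rho> i = Star} = PiE_dflt I 0 (\<lambda>i. if \<rho> i = Star then UNIV else {0})"
    by (auto simp: cube_iff PiE_dflt_def)
  then show ?thesis
    unfolding uniform_on_fixing_cube using assms by (subst Pi_pmf_of_set) auto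
qed

text \<open>Coordinatewise: a star has twice the probability of a 1, and a starred bit is fair, so 1
  gets its original probability.\<close>

lemma random_partial_fixing_mixture:
  assumes "finite I" "zero_biased I \<nu>"
  shows "do {\<rho> \<leftarrow> random_partial_fixing I \<nu>; uniform_on_fixing I \<rho>} = \<nu>"
proof -
  obtain B where B: "\<nu> = Pi_pmf I 0 B"
    using assms(2) by (auto simp: zero_biased_def product_distribution_def)
  define S where "S i = map_pmf (\<lambda>b. if b then Star else Zero) (bernoulli_pmf (star_prob \<nu> i))" for i
  have "B i = do {s \<leftarrow> S i; pmf_of_set (if s = Star then UNIV else {0})}" if "i \<in> I" for i
  proof (rule pmf_bit_eqI)
    \<comment> \<open>The bias towards 0 makes \<open>star_prob\<close> at most 1, a genuine
      Bernoulli parameter.\<close>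
    have "pmf (B i) 1 \<le> 1 / 2"
      using assms that by (auto simp: zero_biased_def B Pi_pmf_prob_component pmf_bit_0)
    then show "pmf (B i) 1 = pmf (do {s \<leftarrow> S i; pmf_of_set (if s = Star then UNIV else {0 :: bit})}) 1"
      using assms(1) that
      by (simp add: S_def bind_map_pmf pmf_bind B star_prob_Pi_pmf) (simp add: UNIV_bit)
  qed
  then have "\<nu> = Pi_pmf I 0 (\<lambda>i. do {s \<leftarrow> S i; pmf_of_set (if s = Star then UNIV else {0})})"
    unfolding B by (intro Pi_pmf_cong) auto
  also have "\<dots> = do {\<rho> \<leftarrow> Pi_pmf I Zero S; uniform_on_fixing I \<rho>}"
    unfolding uniform_on_fixing_Pi_pmf[OF assms(1)] using assms(1) by (rule Pi_pmf_bind)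
  finally show ?thesis
    unfolding random_partial_fixing_def S_def ..
qed

section \<open>Fixings of the power distribution and their blocks\<close>

lemma power_distribution_Pi_pmf:
  assumes "finite J"
  shows "power_distribution k (Pi_pmf J 0 B) = Pi_pmf ({..<k} \<times> J) 0 (\<lambda>(j, l). B l)"
  unfolding power_distribution_def using assms by (intro Pi_pmf_uncurry) auto

lemma zero_biased_power_distribution:
  assumes "finite J" "zero_biased J \<mu>"
  shows "zero_biased ({..<k} \<times> J) (power_distribution k \<mu>)"
proof -
  obtain B where B: "\<mu> = Pi_pmf J 0 B"
    using assms(2) by (auto simp: zero_biased_def product_distribution_def)
  show ?thesis
    using assms
    by (auto simp: B power_distribution_Pi_pmf zero_biased_def product_distribution_def Pi_pmf_prob_component)
qed

lemma random_partial_fixing_power_distribution: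
  assumes "finite J" "zero_biased J \<mu>"
  shows "random_partial_fixing ({..<k} \<times> J) (power_distribution k \<mu>) =
     map_pmf (\<lambda>X (j, l). X j l) (Pi_pmf {..<k} (\<lambda>_. Zero) (\<lambda>_. random_partial_fixing J \<mu>))"
proof -
  obtain B where B: "\<mu> = Pi_pmf J 0 B"
    using assms(2) by (auto simp: zero_biased_def product_distribution_def)
  have "star_prob (power_distribution k \<mu>) q = star_prob \<mu> (snd q)" if "q \<in> {..<k} \<times> J" for q
    using assms(1) that unfolding B
    by (subst power_distribution_Pi_pmf) (auto simp: star_prob_Pi_pmf)
  then show ?thesis
    unfolding random_partial_fixing_def using assms(1)
    by (subst Pi_pmf_uncurry) (auto intro!: Pi_pmf_cong)
qed

definition replace_block :: "'k \<Rightarrow> ('i \<Rightarrow> 'b) \<Rightarrow> ('k \<times> 'i \<Rightarrow> 'b) \<Rightarrow> 'k \<times> 'i \<Rightarrow> 'b" where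
  "replace_block i \<sigma> \<rho> = (\<lambda>(j, l). if j = i then \<sigma> l else \<rho> (j, l))"

lemma block_replace_block [simp]: "block i (replace_block i \<sigma> \<rho>) = \<sigma>"
  by (simp add: block_def replace_block_def)

lemma other_stars_replace_block [simp]:
  "other_stars A J i (replace_block i \<sigma> \<rho>) = other_stars A J i \<rho>"
  by (auto simp: other_stars_def replace_block_def)

text \<open>The blocks of the fixing are independent copies, so this is \<open>Pi_pmf_update\<close>
  after uncurrying.\<close>

lemma random_partial_fixing_replace_block:
  assumes "finite J" "zero_biased J \<mu>" "i < k"
  shows "do {\<sigma> \<leftarrow> random_partial_fixing J \<mu>;
             \<rho> \<leftarrow> random_partial_fixing ({..<k} \<times> J) (power_distribution k \<mu>);
             return_pmf (replace_block i \<sigma> \<rho>)} =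
         random_partial_fixing ({..<k} \<times> J) (power_distribution k \<mu>)"
proof -
  let ?R = "random_partial_fixing J \<mu>"
  let ?u = "\<lambda>X (j, l). X j l"
  have u: "replace_block i \<sigma> (?u X) = ?u (X(i := \<sigma>))" for \<sigma> and X :: "nat \<Rightarrow> 'a \<Rightarrow> fixing"
    by (auto simp: replace_block_def fun_eq_iff)
  have "do {\<sigma> \<leftarrow> ?R; \<rho> \<leftarrow> map_pmf ?u (Pi_pmf {..<k} (\<lambda>_. Zero) (\<lambda>_. ?R));
            return_pmf (replace_block i \<sigma> \<rho>)} =
      map_pmf ?u (do {\<sigma> \<leftarrow> ?R; X \<leftarrow> Pi_pmf {..<k} (\<lambda>_. Zero) (\<lambda>_. ?R); return_pmf (X(i := \<sigma>))})"
    by (simp add: map_bind_pmf bind_map_pmf u del: fun_upd_apply)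
  also have "\<dots> = map_pmf ?u (Pi_pmf {..<k} (\<lambda>_. Zero) (\<lambda>_. ?R))"
    using assms(3) by (subst Pi_pmf_update[where p = "\<lambda>_. ?R"]) auto
  finally show ?thesis
    unfolding random_partial_fixing_power_distribution[OF assms(1,2)] .
qed

text \<open>The free subcube is the direct sum of its part in block \<open>i\<close> and its part in
  the other blocks. Its fibres over block \<open>i\<close> are disjoint and of equal size, so a
  uniform point can be drawn in two stages.\<close>

lemma uniform_on_fixing_block:
  assumes "finite A" "finite J" "i \<in> A"
  shows "do {x \<leftarrow> uniform_on_fixing J (block i \<rho>);
             z \<leftarrow> pmf_of_set (cube (other_stars A J i \<rho>));
             return_pmf (in_block i x + z)} = uniform_on_fixing (A \<times> J) \<rho>"
proof -
  define X where "X = cube {l\<in>J. block i \<rho> l = Star}"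
  define Z where "Z = cube (other_stars A J i \<rho>)"
  define f where "f x = (\<lambda>z. in_block i x + z) ` Z" for x
  have "finite (other_stars A J i \<rho>)"
    using assms(1,2) by (auto simp: other_stars_def intro: finite_subset[of _ "A \<times> J"])
  then have fin: "finite X" "finite Z" "X \<noteq> {}" "Z \<noteq> {}"
    using assms(2) unfolding X_def Z_def by auto
  have block: "block i y = x" if "y \<in> f x" for x y
    using that by (auto simp: f_def Z_def cube_iff other_stars_def block_def in_block_def)
  have "(\<Union>x\<in>X. f x) = cube {q \<in> A \<times> J. \<rho> q = Star}"
  proof
    show "(\<Union>x\<in>X. f x) \<subseteq> cube {q \<in> A \<times> J. \<rho> q = Star}"
      using assms(3) by (auto simp: f_def X_def Z_def cube_iff other_stars_def block_def in_block_def)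
    show "cube {q \<in> A \<times> J. \<rho> q = Star} \<subseteq> (\<Union>x\<in>X. f x)"
    proof
      fix y assume y: "y \<in> cube {q \<in> A \<times> J. \<rho> q = Star}"
      \<comment> \<open>Adding block \<open>i\<close> of \<open>y\<close> to \<open>y\<close> erases
        it, as the characteristic is 2.\<close>
      define z where "z = in_block i (block i y) + y"
      have "block i y \<in> X"
        using y by (auto simp: X_def cube_iff block_def)
      moreover have "z \<in> Z"
        using y by (auto simp: z_def Z_def cube_iff block_def in_block_def other_stars_def)
      moreover have "y = in_block i (block i y) + z"
        unfolding z_def by simp
      ultimately show "y \<in> (\<Union>x\<in>X. f x)"
        unfolding f_def by blast
    qed
  qed
  then have "uniform_on_fixing (A \<times> J) \<rho> = pmf_of_set (\<Union>x\<in>X. f x)"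
    by (simp add: uniform_on_fixing_cube)
  also have "\<dots> = do {x \<leftarrow> pmf_of_set X; pmf_of_set (f x)}"
  proof (rule pmf_of_set_UN)
    show "card (f x) = card Z" if "x \<in> X" for x
      unfolding f_def by (intro card_image inj_onI) simp
    show "disjoint_family_on f X"
      by (auto simp: disjoint_family_on_def dest: block)
  qed (use fin in \<open>auto simp: f_def\<close>)
  also have "\<dots> = do {x \<leftarrow> pmf_of_set X; map_pmf (\<lambda>z. in_block i x + z) (pmf_of_set Z)}"
    unfolding f_def using fin
    by (intro bind_pmf_cong refl map_pmf_of_set_inj[symmetric] inj_onI) simp_all
  finally show ?thesis
    by (simp add: uniform_on_fixing_cube X_def Z_def map_pmf_def)
qed

text \<open>Tonelli for discrete distributions, from the exchange of two independent draws.\<close>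

lemma nn_integral_pmf_commute:
  "(\<integral>\<^sup>+ x. \<integral>\<^sup>+ y. f x y \<partial>measure_pmf N \<partial>measure_pmf M) =
   (\<integral>\<^sup>+ y. \<integral>\<^sup>+ x. f x y \<partial>measure_pmf M \<partial>measure_pmf N)"
proof -
  have "(\<integral>\<^sup>+ q. (case q of (x, y) \<Rightarrow> f x y) \<partial>measure_pmf (do {x \<leftarrow> M; y \<leftarrow> N; return_pmf (x, y)})) =
      (\<integral>\<^sup>+ q. (case q of (x, y) \<Rightarrow> f x y) \<partial>measure_pmf (do {y \<leftarrow> N; x \<leftarrow> M; return_pmf (x, y)}))"
    by (subst bind_commute_pmf) (rule refl)
  then show ?thesis by simp
qed

section \<open>The tree extracted for one block\<close>

text \<open>The fixing is drawn for all blocks, so that replacing its block \<open>i\<close> by an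
  independent fixing \<sigma> yields the same law again. Relabelling the leaves drops the annotation
  and keeps output bit \<open>i\<close>.\<close>

definition block_pdt :: "nat \<Rightarrow> 'i set \<Rightarrow> ('i \<Rightarrow> bit) pmf \<Rightarrow> nat \<Rightarrow>
    (nat \<times> 'i, nat \<Rightarrow> bit) pdt pmf \<Rightarrow> ('i, bit) pdt pmf" where
  "block_pdt k J \<mu> i \<T> =
     do {T \<leftarrow> \<T>;
         \<rho> \<leftarrow> random_partial_fixing ({..<k} \<times> J) (power_distribution k \<mu>);
         t \<leftarrow> simulate (other_stars {..<k} J i \<rho>) i {} (annotate {} T);
         return_pmf (map_pdt (\<lambda>(y, Q). y i) t)}"

text \<open>\<open>simulate_output\<close> with the empty history supplies a uniform
  \<open>z\<close> in the other blocks; together with a uniform \<open>x\<close> in block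
  \<open>i\<close> this is a uniform point of the whole free subcube.\<close>

lemma simulate_uniform_on_fixing:
  assumes "finite A" "finite J" "i \<in> A"
  shows "do {t \<leftarrow> simulate (other_stars A J i \<rho>) i {} T;
             x \<leftarrow> uniform_on_fixing J (block i \<rho>);
             return_pmf (x, pdt_output J t x)} =
         do {y \<leftarrow> uniform_on_fixing (A \<times> J) \<rho>;
             return_pmf (block i y, pdt_output (A \<times> J) T y)}"
proof -
  define P where "P = other_stars A J i \<rho>"
  define U where "U = uniform_on_fixing J (block i \<rho>)"
  have P: "P \<subseteq> A \<times> J"
    by (auto simp: P_def other_stars_def)
  then have "finite P"
    using assms(1,2) finite_subset by blast
  have cons: "consistent (A \<times> J) P {} y = cube P" for y
    by (simp add: consistent_def)
  \<comment> \<open>The input is drawn first, because \<open>simulate_output\<close> speaks about a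
    fixed \<open>x\<close>.\<close>
  have "do {t \<leftarrow> simulate P i {} T; x \<leftarrow> U; return_pmf (x, pdt_output J t x)} =
      do {x \<leftarrow> U; map_pmf (Pair x) (map_pmf (\<lambda>t. pdt_output J t x) (simulate P i {} T))}"
    by (subst bind_commute_pmf) (simp add: map_pmf_def bind_assoc_pmf bind_return_pmf)
  also have "\<dots> = do {x \<leftarrow> U; map_pmf (Pair x)
      (map_pmf (\<lambda>z. pdt_output (A \<times> J) T (in_block i x + z)) (pmf_of_set (cube P)))}"
    using simulate_output[OF assms P finite.emptyI, of _ T] by (simp only: cons cube_not_empty not_False_eq_True)
  also have "\<dots> = do {x \<leftarrow> U; z \<leftarrow> pmf_of_set (cube P);
      return_pmf (block i (in_block i x + z), pdt_output (A \<times> J) T (in_block i x + z))}"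
  proof (unfold map_pmf_def bind_assoc_pmf bind_return_pmf, intro bind_pmf_cong refl)
    fix x z assume "z \<in> set_pmf (pmf_of_set (cube P))"
    then have "z \<in> cube P"
      using \<open>finite P\<close> by (simp add: set_pmf_of_set)
    \<comment> \<open>\<open>P\<close> avoids block \<open>i\<close>, so the input can be read off
      the sum.\<close>
    then have "block i z = 0"
      by (auto simp: P_def cube_iff other_stars_def block_def fun_eq_iff)
    then show "return_pmf (x, pdt_output (A \<times> J) T (in_block i x + z)) =
        return_pmf (block i (in_block i x + z), pdt_output (A \<times> J) T (in_block i x + z))"
      by (simp add: block_add)
  qed
  also have "\<dots> = do {y \<leftarrow> do {x \<leftarrow> U; z \<leftarrow> pmf_of_set (cube P); return_pmf (in_block i x + z)};
      return_pmf (block i y, pdt_output (A \<times> J) T y)}"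
    by (simp only: bind_assoc_pmf bind_return_pmf)
  also have "do {x \<leftarrow> U; z \<leftarrow> pmf_of_set (cube P); return_pmf (in_block i x + z)} =
      uniform_on_fixing (A \<times> J) \<rho>"
    unfolding P_def U_def using assms by (rule uniform_on_fixing_block)
  finally show ?thesis
    unfolding P_def U_def .
qed

text \<open>
  The partial fixing of block \<open>i\<close> that the skew cost averages over and the one drawn by the
  simulation for the other blocks together form a partial fixing of all blocks.
\<close>
lemma simulate_joint_distribution:
  assumes "finite J" "zero_biased J \<mu>" "i < k"
  shows "do {\<sigma> \<leftarrow> random_partial_fixing J \<mu>;
             \<rho> \<leftarrow> random_partial_fixing ({..<k} \<times> J) (power_distribution k \<mu>);
             t \<leftarrow> simulate (other_stars {..<k} J i \<rho>) i {} T;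
             x \<leftarrow> uniform_on_fixing J \<sigma>;
             return_pmf (replace_block i \<sigma> \<rho>, x, pdt_output J t x)} =
         do {\<rho> \<leftarrow> random_partial_fixing ({..<k} \<times> J) (power_distribution k \<mu>);
             y \<leftarrow> uniform_on_fixing ({..<k} \<times> J) \<rho>;
             return_pmf (\<rho>, block i y, pdt_output ({..<k} \<times> J) T y)}"
proof -
  let ?R = "random_partial_fixing J \<mu>"
  let ?RR = "random_partial_fixing ({..<k} \<times> J) (power_distribution k \<mu>)"
  \<comment> \<open>The law on the left depends on \<sigma> and \<rho> only through the merged
    fixing: its block \<open>i\<close> is \<sigma>, and its stars elsewhere are those of
    \<rho>.\<close>
  define F where "F \<rho> = map_pmf (Pair \<rho>) (do {y \<leftarrow> uniform_on_fixing ({..<k} \<times> J) \<rho>;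
      return_pmf (block i y, pdt_output ({..<k} \<times> J) T y)})" for \<rho>
  have "do {t \<leftarrow> simulate (other_stars {..<k} J i \<rho>) i {} T;
             x \<leftarrow> uniform_on_fixing J \<sigma>;
             return_pmf (replace_block i \<sigma> \<rho>, x, pdt_output J t x)} = F (replace_block i \<sigma> \<rho>)" for \<sigma> \<rho>
    unfolding F_def using assms(1,3)
    by (subst simulate_uniform_on_fixing[symmetric]) (auto simp: map_bind_pmf)
  then have "do {\<sigma> \<leftarrow> ?R; \<rho> \<leftarrow> ?RR;
             t \<leftarrow> simulate (other_stars {..<k} J i \<rho>) i {} T;
             x \<leftarrow> uniform_on_fixing J \<sigma>;
             return_pmf (replace_block i \<sigma> \<rho>, x, pdt_output J t x)} =
      do {\<rho> \<leftarrow> do {\<sigma> \<leftarrow> ?R; \<rho> \<leftarrow> ?RR; return_pmf (replace_block i \<sigma> \<rho>)}; F \<rho>}"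
    by (simp add: bind_assoc_pmf bind_return_pmf)
  also have "\<dots> = do {\<rho> \<leftarrow> ?RR; F \<rho>}"
    unfolding random_partial_fixing_replace_block[OF assms] ..
  finally show ?thesis
    by (simp add: F_def map_bind_pmf)
qed

lemma block_pdt_randomised:
  assumes "\<T> \<in> randomised_pdts ({..<k} \<times> J) Y"
  shows "block_pdt k J \<mu> i \<T> \<in> randomised_pdts J UNIV"
proof -
  have "pdt_over J UNIV (map_pdt g t)"
    if "T \<in> set_pmf \<T>" "t \<in> set_pmf (simulate P i {} (annotate {} T))" for P T t and g :: "_ \<Rightarrow> bit"
  proof -
    have "pdt_over ({..<k} \<times> J) Y T"
      using assms that(1) by (auto simp: randomised_pdts_def)
    then have "pdt_over ({..<k} \<times> J) (Y \<times> UNIV) (annotate {} T)"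
      using pdt_over_annotate[of _ Y T "\<lambda>_. True"] by simp
    from pdt_over_simulate[OF finite.emptyI that(2) this] have "pdt_over J (Y \<times> UNIV) t"
      by simp
    then show ?thesis by (rule pdt_over_map_pdt) simp
  qed
  then show ?thesis
    unfolding randomised_pdts_def block_pdt_def by auto
qed

section \<open>Error and cost of the extracted trees\<close>

lemma err_eq:
  "err I g \<T> \<nu> = measure_pmf.prob (do {T \<leftarrow> \<T>; x \<leftarrow> \<nu>; return_pmf (pdt_output I T x, x)}) {(r, x). r \<noteq> g x}"
proof -
  have "do {T \<leftarrow> \<T>; x \<leftarrow> \<nu>; return_pmf (pdt_output I T x, x)} =
      map_pmf (\<lambda>(T, x). (pdt_output I T x, x)) (pair_pmf \<T> \<nu>)"
    by (simp add: pair_pmf_def map_bind_pmf)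
  then show ?thesis
    by (simp add: err_def vimage_def case_prod_beta')
qed

text \<open>Input and output of the extracted tree are jointly distributed like block
  \<open>i\<close> and output bit \<open>i\<close> of the given tree on the power
  distribution.\<close>

lemma err_block_pdt_le:
  assumes "finite J" "zero_biased J \<mu>" "i < k"
  shows "err J f (block_pdt k J \<mu> i \<T>) \<mu>
           \<le> err ({..<k} \<times> J) (direct_power k f) \<T> (power_distribution k \<mu>)"
proof -
  let ?I = "{..<k} \<times> J"
  let ?\<nu> = "power_distribution k \<mu>"
  let ?R = "random_partial_fixing J \<mu>"
  let ?RR = "random_partial_fixing ?I ?\<nu>"
  let ?sim = "\<lambda>\<rho> T. simulate (other_stars {..<k} J i \<rho>) i {} (annotate {} T)"
  have \<nu>: "do {\<rho> \<leftarrow> ?RR; uniform_on_fixing ?I \<rho>} = ?\<nu>"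
    using assms by (intro random_partial_fixing_mixture zero_biased_power_distribution) auto
  have out: "pdt_output J (map_pdt (\<lambda>(y, Q). y i) t) x = fst (pdt_output J t x) i"
    for t :: "('a, (nat \<Rightarrow> bit) \<times> (nat \<times> 'a \<Rightarrow> bit) set) pdt" and x
    by (simp add: pdt_output_map_pdt case_prod_beta)
  have "do {t \<leftarrow> block_pdt k J \<mu> i \<T>; x \<leftarrow> \<mu>; return_pmf (pdt_output J t x, x)} =
      do {T \<leftarrow> \<T>; \<rho> \<leftarrow> ?RR; t \<leftarrow> ?sim \<rho> T; \<sigma> \<leftarrow> ?R; x \<leftarrow> uniform_on_fixing J \<sigma>;
          return_pmf (fst (pdt_output J t x) i, x)}"
    \<comment> \<open>The input distribution is written as a mixture over fixings \<sigma>; the next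
      two steps move \<sigma> to the front, as \<open>simulate_joint_distribution\<close>
      requires.\<close>
    by (subst (2) random_partial_fixing_mixture[OF assms(1,2), symmetric])
       (simp only: block_pdt_def bind_assoc_pmf bind_return_pmf out)
  also have "\<dots> = do {T \<leftarrow> \<T>; \<rho> \<leftarrow> ?RR; \<sigma> \<leftarrow> ?R; t \<leftarrow> ?sim \<rho> T; x \<leftarrow> uniform_on_fixing J \<sigma>;
          return_pmf (fst (pdt_output J t x) i, x)}"
    by (intro bind_pmf_cong refl bind_commute_pmf)
  also have "\<dots> = do {T \<leftarrow> \<T>; \<sigma> \<leftarrow> ?R; \<rho> \<leftarrow> ?RR; t \<leftarrow> ?sim \<rho> T; x \<leftarrow> uniform_on_fixing J \<sigma>;
          return_pmf (fst (pdt_output J t x) i, x)}"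
    by (intro bind_pmf_cong refl bind_commute_pmf)
  also have "\<dots> = do {T \<leftarrow> \<T>;
      map_pmf (\<lambda>(\<rho>, x, r). (fst r i, x)) (do {\<sigma> \<leftarrow> ?R; \<rho> \<leftarrow> ?RR; t \<leftarrow> ?sim \<rho> T;
        x \<leftarrow> uniform_on_fixing J \<sigma>; return_pmf (replace_block i \<sigma> \<rho>, x, pdt_output J t x)})}"
    by (simp add: map_bind_pmf)
  also have "\<dots> = do {T \<leftarrow> \<T>; \<rho> \<leftarrow> ?RR; y \<leftarrow> uniform_on_fixing ?I \<rho>;
      return_pmf (pdt_output ?I T y i, block i y)}"
    unfolding simulate_joint_distribution[OF assms]
    by (simp add: map_bind_pmf pdt_output_annotate)
  also have "\<dots> = do {T \<leftarrow> \<T>; y \<leftarrow> do {\<rho> \<leftarrow> ?RR; uniform_on_fixing ?I \<rho>};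
      return_pmf (pdt_output ?I T y i, block i y)}"
    by (simp only: bind_assoc_pmf)
  also have "\<dots> = map_pmf (\<lambda>(r, y). (r i, block i y))
      (do {T \<leftarrow> \<T>; y \<leftarrow> ?\<nu>; return_pmf (pdt_output ?I T y, y)})"
    unfolding \<nu> by (simp add: map_bind_pmf)
  finally have "err J f (block_pdt k J \<mu> i \<T>) \<mu> =
      measure_pmf.prob (do {T \<leftarrow> \<T>; y \<leftarrow> ?\<nu>; return_pmf (pdt_output ?I T y, y)})
        {(r, y). r i \<noteq> f (block i y)}"
    by (simp add: err_eq vimage_def case_prod_beta')
  \<comment> \<open>A wrong bit \<open>i\<close> makes the whole output wrong.\<close>
  also have "\<dots> \<le> err ?I (direct_power k f) \<T> ?\<nu>"
    unfolding err_eq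
    by (intro measure_pmf.finite_measure_mono) (use assms(3) in \<open>auto simp: direct_power_def block_def\<close>)
  finally show ?thesis .
qed

text \<open>Pointwise the cost is at most a block rank that depends only on the merged fixing and
  the annotation at the leaf. By \<open>simulate_joint_distribution\<close> these are distributed as
  in a run of the given tree on all blocks.\<close>

lemma skew_cost_block_pdt_le:
  assumes "finite J" "zero_biased J \<mu>" "i < k" "\<T> \<in> randomised_pdts ({..<k} \<times> J) Y"
  shows "skew_cost J (block_pdt k J \<mu> i \<T>) \<mu> \<le>
    (\<integral>\<^sup>+ T. \<integral>\<^sup>+ \<rho>. \<integral>\<^sup>+ y.
        of_nat (block_rank i (bitvec.span (restrict_query \<rho> ` path_queries ({..<k} \<times> J) T y)))
      \<partial>measure_pmf (uniform_on_fixing ({..<k} \<times> J) \<rho>)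
      \<partial>measure_pmf (random_partial_fixing ({..<k} \<times> J) (power_distribution k \<mu>))
      \<partial>measure_pmf \<T>)"
proof -
  let ?I = "{..<k} \<times> J"
  let ?R = "random_partial_fixing J \<mu>"
  let ?RR = "random_partial_fixing ?I (power_distribution k \<mu>)"
  let ?sim = "\<lambda>\<rho> T. simulate (other_stars {..<k} J i \<rho>) i {} (annotate {} T)"
  let ?U = "uniform_on_fixing J"
  \<comment> \<open>Here \<open>snd r\<close> is the annotation of the leaf reached, that is, the
    original unrestricted queries.\<close>
  define rank :: "(nat \<times> 'a \<Rightarrow> fixing) \<Rightarrow> (nat \<Rightarrow> bit) \<times> (nat \<times> 'a \<Rightarrow> bit) set \<Rightarrow> ennreal"
    where "rank \<rho> r = of_nat (block_rank i (bitvec.span (restrict_query \<rho> ` snd r)))" for \<rho> r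
  have le: "of_nat (num_queries J (fix_tree \<sigma> t) x) \<le> rank (replace_block i \<sigma> \<rho>) (pdt_output J t x)"
    if "T \<in> set_pmf \<T>" "t \<in> set_pmf (?sim \<rho> T)" "x \<in> set_pmf (?U \<sigma>)" for \<sigma> \<rho> T t x
  proof -
    have "pdt_over ?I Y T"
      using assms(4) that(1) by (auto simp: randomised_pdts_def)
    moreover have "x l = 0" if "l \<in> J" "replace_block i \<sigma> \<rho> (i, l) = Zero" for l
      using \<open>x \<in> _\<close> that assms(1)
      by (auto simp: set_uniform_on_fixing cube_iff replace_block_def)
    ultimately have "num_queries J (fix_tree (block i (replace_block i \<sigma> \<rho>)) t) x
        \<le> block_rank i (bitvec.span (restrict_query (replace_block i \<sigma> \<rho>) ` snd (pdt_output J t x)))"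
      using assms(1,3) that(2) by (intro num_queries_simulate_le[where A = "{..<k}"]) auto
    then show ?thesis by (simp add: rank_def)
  qed
  have "skew_cost J (block_pdt k J \<mu> i \<T>) \<mu> =
      (\<integral>\<^sup>+ \<sigma>. \<integral>\<^sup>+ T. \<integral>\<^sup>+ \<rho>. \<integral>\<^sup>+ t. \<integral>\<^sup>+ x. of_nat (num_queries J (fix_tree \<sigma> t) x)
        \<partial>measure_pmf (?U \<sigma>) \<partial>measure_pmf (?sim \<rho> T) \<partial>measure_pmf ?RR \<partial>measure_pmf \<T> \<partial>measure_pmf ?R)"
    by (simp add: skew_cost_def avg_queries_def nn_integral_pair_pmf' block_pdt_def fix_tree_def
        fix_tree_aux_map_pdt num_queries_map_pdt)
  also have "\<dots> \<le> (\<integral>\<^sup>+ \<sigma>. \<integral>\<^sup>+ T. \<integral>\<^sup>+ \<rho>. \<integral>\<^sup>+ t. \<integral>\<^sup>+ x. rank (replace_block i \<sigma> \<rho>) (pdt_output J t x)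
        \<partial>measure_pmf (?U \<sigma>) \<partial>measure_pmf (?sim \<rho> T) \<partial>measure_pmf ?RR \<partial>measure_pmf \<T> \<partial>measure_pmf ?R)"
    by (intro nn_integral_mono_AE AE_pmfI le)
  also have "\<dots> = (\<integral>\<^sup>+ T. \<integral>\<^sup>+ \<sigma>. \<integral>\<^sup>+ \<rho>. \<integral>\<^sup>+ t. \<integral>\<^sup>+ x. rank (replace_block i \<sigma> \<rho>) (pdt_output J t x)
        \<partial>measure_pmf (?U \<sigma>) \<partial>measure_pmf (?sim \<rho> T) \<partial>measure_pmf ?RR \<partial>measure_pmf ?R \<partial>measure_pmf \<T>)"
    by (rule nn_integral_pmf_commute)
  also have "\<dots> = (\<integral>\<^sup>+ T. \<integral>\<^sup>+ q. (case q of (\<rho>, x, r) \<Rightarrow> rank \<rho> r)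
      \<partial>measure_pmf (do {\<sigma> \<leftarrow> ?R; \<rho> \<leftarrow> ?RR; t \<leftarrow> ?sim \<rho> T; x \<leftarrow> ?U \<sigma>;
        return_pmf (replace_block i \<sigma> \<rho>, x, pdt_output J t x)}) \<partial>measure_pmf \<T>)"
    by simp
  also have "\<dots> = (\<integral>\<^sup>+ T. \<integral>\<^sup>+ \<rho>. \<integral>\<^sup>+ y. rank \<rho> (pdt_output ?I (annotate {} T) y)
      \<partial>measure_pmf (uniform_on_fixing ?I \<rho>) \<partial>measure_pmf ?RR \<partial>measure_pmf \<T>)"
    unfolding simulate_joint_distribution[OF assms(1-3)] by simp
  finally show ?thesis
    by (simp add: rank_def pdt_output_annotate)
qed

text \<open>All the bounds are now averages over the same runs of the given tree, so the block ranks
  can be added inside the integral and compared with its cost pointwise.\<close>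

lemma sum_skew_cost_block_pdt_le:
  assumes "finite J" "zero_biased J \<mu>" "\<T> \<in> randomised_pdts ({..<k} \<times> J) Y"
  shows "(\<Sum>i<k. skew_cost J (block_pdt k J \<mu> i \<T>) \<mu>)
           \<le> skew_cost ({..<k} \<times> J) \<T> (power_distribution k \<mu>)"
proof -
  let ?I = "{..<k} \<times> J"
  let ?RR = "random_partial_fixing ?I (power_distribution k \<mu>)"
  let ?U = "uniform_on_fixing ?I"
  let ?rank = "\<lambda>i \<rho> T y. of_nat (block_rank i (bitvec.span (restrict_query \<rho> ` path_queries ?I T y))) :: ennreal"
  have le: "(\<Sum>i<k. ?rank i \<rho> T y) \<le> of_nat (num_queries ?I (fix_tree \<rho> T) y)"
    if "y \<in> set_pmf (?U \<rho>)" for \<rho> T y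
  proof -
    have "y q = 0" if "q \<in> ?I" "\<rho> q = Zero" for q
      using \<open>y \<in> _\<close> that assms(1) by (auto simp: set_uniform_on_fixing cube_iff)
    then have "(\<Sum>i<k. block_rank i (bitvec.span (restrict_query \<rho> ` path_queries ?I T y)))
        \<le> num_queries ?I (fix_tree \<rho> T) y"
      by (intro sum_block_rank_path_queries_le) auto
    then show ?thesis
      by (simp only: of_nat_sum[symmetric] of_nat_le_iff)
  qed
  have "(\<Sum>i<k. skew_cost J (block_pdt k J \<mu> i \<T>) \<mu>) \<le>
      (\<Sum>i<k. \<integral>\<^sup>+ T. \<integral>\<^sup>+ \<rho>. \<integral>\<^sup>+ y. ?rank i \<rho> T y \<partial>measure_pmf (?U \<rho>) \<partial>measure_pmf ?RR \<partial>measure_pmf \<T>)"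
    using assms by (intro sum_mono skew_cost_block_pdt_le) auto
  also have "\<dots> = (\<integral>\<^sup>+ T. \<integral>\<^sup>+ \<rho>. \<integral>\<^sup>+ y. (\<Sum>i<k. ?rank i \<rho> T y)
      \<partial>measure_pmf (?U \<rho>) \<partial>measure_pmf ?RR \<partial>measure_pmf \<T>)"
    by (simp add: nn_integral_sum)
  also have "\<dots> \<le> (\<integral>\<^sup>+ T. \<integral>\<^sup>+ \<rho>. \<integral>\<^sup>+ y. of_nat (num_queries ?I (fix_tree \<rho> T) y)
      \<partial>measure_pmf (?U \<rho>) \<partial>measure_pmf ?RR \<partial>measure_pmf \<T>)"
    by (intro nn_integral_mono_AE AE_pmfI le)
  also have "\<dots> = (\<integral>\<^sup>+ \<rho>. \<integral>\<^sup>+ T. \<integral>\<^sup>+ y. of_nat (num_queries ?I (fix_tree \<rho> T) y)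
      \<partial>measure_pmf (?U \<rho>) \<partial>measure_pmf \<T> \<partial>measure_pmf ?RR)"
    by (rule nn_integral_pmf_commute)
  also have "\<dots> = skew_cost ?I \<T> (power_distribution k \<mu>)"
    by (simp add: skew_cost_def avg_queries_def nn_integral_pair_pmf')
  finally show ?thesis .
qed

theorem theorem17:
  fixes n k :: nat
    and f :: "(nat \<Rightarrow> bit) \<Rightarrow> bit"
    and \<mu> :: "(nat \<Rightarrow> bit) pmf"
    and \<epsilon> :: real
  assumes "zero_biased {..<n} \<mu>"
    and "k \<ge> 1"
    and "\<epsilon> \<ge> 0"
  shows "skew_measure ({..<k} \<times> {..<n}) (cube {..<k}) \<epsilon> (direct_power k f) (power_distribution k \<mu>)
           \<ge> of_nat k * skew_measure {..<n} UNIV \<epsilon> f \<mu>"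
proof -
  let ?I = "{..<k} \<times> {..<n}"
  have "of_nat k * skew_measure {..<n} UNIV \<epsilon> f \<mu> \<le> skew_cost ?I \<T> (power_distribution k \<mu>)"
    if \<T>: "\<T> \<in> randomised_pdts ?I (cube {..<k})"
      and err: "err ?I (direct_power k f) \<T> (power_distribution k \<mu>) \<le> \<epsilon>" for \<T>
  proof -
    have "of_nat k * skew_measure {..<n} UNIV \<epsilon> f \<mu> = (\<Sum>i<k. skew_measure {..<n} UNIV \<epsilon> f \<mu>)"
      by simp
    also have "\<dots> \<le> (\<Sum>i<k. skew_cost {..<n} (block_pdt k {..<n} \<mu> i \<T>) \<mu>)"
    proof (rule sum_mono)
      fix i assume "i \<in> {..<k}"
      \<comment> \<open>Each extracted tree is admissible for \<open>f\<close> with the same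
        \<epsilon>, so its cost bounds the skew measure from above.\<close>
      then have "err {..<n} f (block_pdt k {..<n} \<mu> i \<T>) \<mu> \<le> \<epsilon>"
        using err_block_pdt_le[OF finite_lessThan assms(1), of i k f \<T>] err by simp
      then show "skew_measure {..<n} UNIV \<epsilon> f \<mu> \<le> skew_cost {..<n} (block_pdt k {..<n} \<mu> i \<T>) \<mu>"
        unfolding skew_measure_def using block_pdt_randomised[OF \<T>] by (intro INF_lower) simp
    qed
    also have "\<dots> \<le> skew_cost ?I \<T> (power_distribution k \<mu>)"
      using assms(1) \<T> by (intro sum_skew_cost_block_pdt_le) auto
    finally show ?thesis .
  qed
  then show ?thesis
    unfolding skew_measure_def[of ?I] by (intro INF_greatest) simp
qed

end
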